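(* For $i=1,\dots,m$ let $A_i$ be a symmetric positive definite $n\times n$ matrix with minimum and maximum eigenvalues $\mu^i_{\min}$ and $\mu^i_{\max}$, let $x_i\in\mathbb{R}^n$ and $r_i>0$, and assume that $$\beta_i(x)=(x-x_i)^TA_i(x-x_i)-\mu^i_{\min}r_i^2 .$$ Let $d_i=\|x_i-x^*\|$ and suppose that for every $i=1,\dots,m$ $$\frac{\lambda_{\max}}{\lambda_{\min}}\,\frac{\mu^i_{\max}}{\mu^i_{\min}}<1+\frac{d_i}{r_i}.$$ Then for every $\varepsilon>0$ there exists a constant $K(\varepsilon)$ such that, for every $k>K(\varepsilon)$, the function $\varphi_k:\mathcal{F}\to[0,1]$ is a navigation function with minimum at some point $\bar x$ satisfying $\|\bar x-x^*\|<\varepsilon$. Furthermore, if $f_0(x^* )=0$ or $\nabla\beta(x^* )=0$, then $\bar x=x^*$.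
   Context: Setting. $\mathcal{X}\subset\mathbb{R}^n$ is a nonempty compact convex set. $\beta_0:\mathbb{R}^n\to\mathbb{R}$ is a twice continuously differentiable concave function with $\mathcal{X}=\{x:\beta_0(x)\ge 0\}$ and $\partial\mathcal{X}=\{x:\beta_0(x)=0\}$. The obstacles are the open ellipsoids $\mathcal{O}_i=\{x:\beta_i(x)<0\}\subset\mathcal{X}$, $i=1,\dots,m$, with $\beta_i$ as in the claim ($x_i$ is the center and $r_i$ the length of the largest semi-axis of $\mathcal{O}_i$). Put $\beta(x)=\prod_{i=0}^m\beta_i(x)$. The free space is $\mathcal{F}=\{x\in\mathbb{R}^n:\beta(x)\ge 0\}=\mathcal{X}\setminus\bigcup_{i=1}^m\mathcal{O}_i$. Obstacles do not intersect: for every $x\in\mathbb{R}^n$, if $\beta_i(x)\le 0$ for some $i\in\{0,\dots,m\}$, then $\beta_j(x)>0$ for all $j\in\{0,\dots,m\}$, $j\ne i$. Objective: $f_0:\mathcal{X}\to\mathbb{R}_+$ (nonnegative values) is twice continuously differentiable and strongly convex on $\mathcal{X}$, with the eigenvalues of $\nabla^2 f_0(x)$ contained in $[\lambda_{\min},\lambda_{\max}]$, $\lambda_{\min}>0$, for all $x\in\mathcal{X}$; its minimizer $x^*=\arg\min f_0$ lies in $\mathrm{int}(\mathcal{F})$ (so $\nabla f_0(x^* )=0$ and $f_0(x^* )\ge0$). Artificial potential: for a real parameter $k>0$, $\varphi_k(x)=\dfrac{f_0(x)}{\left(f_0^k(x)+\beta(x)\right)^{1/k}}$, $x\in\mathcal{F}$.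 Navigation function. $\mathcal{F}$ is assumed to be a compact connected analytic manifold with boundary. A map $\varphi:\mathcal{F}\to[0,1]$ is a navigation function with minimum at $p\in\mathrm{int}(\mathcal{F})$ if: (Differentiable) $\varphi$ is twice continuously differentiable in $\mathcal{F}$; (Polar) $\varphi$ has a unique (local) minimum, located at $p$; (Morse) all critical points of $\varphi$ on $\mathcal{F}$ are nondegenerate; (Admissible) $\partial\mathcal{F}=\varphi^{-1}(1)$. *)

theory Defs
  imports "HOL-Analysis.Analysis"
begin

(* C^2 calculus on a set S, with gradient g and Hessian H. Derivatives are taken within S, so that
   boundary points are included; at interior points they are the ordinary ones. On the sets used
   below (the whole space, convex sets with interior points, the free space) every point of S is
   approached from inside S along an open cone of directions, hence g and H are uniquely
   determined on S by f. *)

definition has_C2_derivs_on ::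
  "(real^'n \<Rightarrow> real) \<Rightarrow> (real^'n \<Rightarrow> real^'n) \<Rightarrow> (real^'n \<Rightarrow> real^'n^'n) \<Rightarrow> (real^'n) set \<Rightarrow> bool" where
  "has_C2_derivs_on f g H S \<longleftrightarrow>
     (\<forall>x\<in>S. (f has_derivative (\<lambda>h. h \<bullet> g x)) (at x within S)) \<and>
     (\<forall>x\<in>S. (g has_derivative (\<lambda>h. H x *v h)) (at x within S)) \<and>
     continuous_on S H"

definition C2_on :: "(real^'n \<Rightarrow> real) \<Rightarrow> (real^'n) set \<Rightarrow> bool" where
  "C2_on f S \<longleftrightarrow> (\<exists>g H. has_C2_derivs_on f g H S)"

definition strongly_convex_on :: "'a::real_inner set \<Rightarrow> ('a \<Rightarrow> real) \<Rightarrow> bool" where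
  "strongly_convex_on S f \<longleftrightarrow> (\<exists>c>0. convex_on S (\<lambda>x. f x - c / 2 * (norm x)\<^sup>2))"

definition eigenvalues :: "real^'n^'n \<Rightarrow> real set" where
  "eigenvalues A = {c. \<exists>v. v \<noteq> 0 \<and> A *v v = c *\<^sub>R v}"

(* Min and Max are meaningful here because a real symmetric matrix has a finite nonempty set of
   real eigenvalues; these are only used for symmetric matrices. *)
definition min_eigenvalue :: "real^'n^'n \<Rightarrow> real" where
  "min_eigenvalue A = Min (eigenvalues A)"

definition max_eigenvalue :: "real^'n^'n \<Rightarrow> real" where
  "max_eigenvalue A = Max (eigenvalues A)"

definition pos_def :: "real^'n^'n \<Rightarrow> bool" where
  "pos_def A \<longleftrightarrow> (\<forall>x. x \<noteq> 0 \<longrightarrow> 0 < x \<bullet> (A *v x))"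

(* alpha ranges over all multi-indices; has_sum is unconditional (absolute) convergence. *)
definition real_analytic_on :: "(real^'n \<Rightarrow> real) \<Rightarrow> (real^'n) set \<Rightarrow> bool" where
  "real_analytic_on f U \<longleftrightarrow>
     (\<forall>a\<in>U. \<exists>(c :: ('n \<Rightarrow> nat) \<Rightarrow> real) e. e > 0 \<and>
        (\<forall>x\<in>ball a e. ((\<lambda>\<alpha>. c \<alpha> * (\<Prod>i\<in>UNIV. (x $ i - a $ i) ^ \<alpha> i)) has_sum f x) UNIV))"

definition real_analytic_map_on :: "(real^'n \<Rightarrow> real^'n) \<Rightarrow> (real^'n) set \<Rightarrow> bool" where
  "real_analytic_map_on \<psi> U \<longleftrightarrow> (\<forall>j. real_analytic_on (\<lambda>x. \<psi> x $ j) U)"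

(* Embedded, of full dimension: around each point an analytic diffeomorphism psi between open sets
   of the ambient space straightens F to a half-space. Interior points are covered as well, by
   charts whose image V lies in the open half-space. The manifold boundary is the frontier of F. *)
definition analytic_manifold_with_boundary :: "(real^'n) set \<Rightarrow> bool" where
  "analytic_manifold_with_boundary F \<longleftrightarrow>
     (\<forall>p\<in>F. \<exists>U V \<psi> \<psi>' j. open U \<and> open V \<and> p \<in> U \<and> homeomorphism U V \<psi> \<psi>' \<and>
        real_analytic_map_on \<psi> U \<and> real_analytic_map_on \<psi>' V \<and>
        \<psi> ` (U \<inter> F) = {y \<in> V. 0 \<le> y $ j})"

definition local_min_on :: "'a::metric_space set \<Rightarrow> ('a \<Rightarrow> real) \<Rightarrow> 'a \<Rightarrow> bool" where
  "local_min_on F \<phi> p \<longleftrightarrow> p \<in> F \<and> (\<exists>e>0. \<forall>y \<in> F \<inter> ball p e. \<phi> p \<le> \<phi> y)"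

(* A C^2 function that is Morse: critical points on the boundary of F count too. *)
definition C2_Morse_on :: "(real^'n \<Rightarrow> real) \<Rightarrow> (real^'n) set \<Rightarrow> bool" where
  "C2_Morse_on \<phi> F \<longleftrightarrow>
     (\<exists>g H. has_C2_derivs_on \<phi> g H F \<and> (\<forall>x\<in>F. g x = 0 \<longrightarrow> det (H x) \<noteq> 0))"

definition navigation_function :: "(real^'n) set \<Rightarrow> (real^'n \<Rightarrow> real) \<Rightarrow> real^'n \<Rightarrow> bool" where
  "navigation_function F \<phi> p \<longleftrightarrow>
     \<phi> \<in> F \<rightarrow> {0..1} \<and>
     p \<in> interior F \<and>
     C2_on \<phi> F \<and>
     {x. local_min_on F \<phi> x} = {p} \<and>
     C2_Morse_on \<phi> F \<and>
     frontier F = {x \<in> F. \<phi> x = 1}"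

(* Index 0 is the workspace, indices 1..m are the obstacles. *)
definition total_beta :: "nat \<Rightarrow> (nat \<Rightarrow> real^'n \<Rightarrow> real) \<Rightarrow> real^'n \<Rightarrow> real" where
  "total_beta m b x = (\<Prod>i\<in>{0..m}. b i x)"

definition free_space :: "nat \<Rightarrow> (nat \<Rightarrow> real^'n \<Rightarrow> real) \<Rightarrow> (real^'n) set" where
  "free_space m b = {x. total_beta m b x \<ge> 0}"

definition obstacle :: "(nat \<Rightarrow> real^'n \<Rightarrow> real) \<Rightarrow> nat \<Rightarrow> (real^'n) set" where
  "obstacle b i = {x. b i x < 0}"

definition potential ::
  "(real^'n \<Rightarrow> real) \<Rightarrow> nat \<Rightarrow> (nat \<Rightarrow> real^'n \<Rightarrow> real) \<Rightarrow> real \<Rightarrow> real^'n \<Rightarrow> real" where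
  "potential f0 m b k x = f0 x / ((f0 x powr k + total_beta m b x) powr (1 / k))"

definition obstacles_disjoint :: "nat \<Rightarrow> (nat \<Rightarrow> real^'n \<Rightarrow> real) \<Rightarrow> bool" where
  "obstacles_disjoint m b \<longleftrightarrow>
     (\<forall>x. \<forall>i\<in>{0..m}. b i x \<le> 0 \<longrightarrow> (\<forall>j\<in>{0..m}. j \<noteq> i \<longrightarrow> b j x > 0))"

lemma free_space_eq:
  assumes "obstacles_disjoint m b"
  shows "free_space m b = {x. b 0 x \<ge> 0} - (\<Union>i\<in>{1..m}. obstacle b i)"
proof -
  have "total_beta m b x \<ge> 0 \<longleftrightarrow> (\<forall>i\<in>{0..m}. b i x \<ge> 0)" for x
  proof
    assume nonneg: "total_beta m b x \<ge> 0"
    show "\<forall>i\<in>{0..m}. b i x \<ge> 0"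
    proof (rule ccontr)
      assume "\<not> (\<forall>i\<in>{0..m}. b i x \<ge> 0)"
      then obtain i where i: "i \<in> {0..m}" "b i x < 0" by force
      have "(\<Prod>j\<in>{0..m} - {i}. b j x) > 0"
        using assms i by (intro prod_pos) (auto simp: obstacles_disjoint_def dest!: spec[of _ x])
      moreover have "total_beta m b x = b i x * (\<Prod>j\<in>{0..m} - {i}. b j x)"
        unfolding total_beta_def using i by (intro prod.remove) auto
      ultimately show False using nonneg i(2) by (simp add: zero_le_mult_iff)
    qed
  next
    assume "\<forall>i\<in>{0..m}. b i x \<ge> 0"
    then show "total_beta m b x \<ge> 0"
      unfolding total_beta_def by (intro prod_nonneg) auto
  qed
  moreover have "{0..m} = insert 0 {1..m}" by auto
  ultimately show ?thesis
    by (auto simp: free_space_def obstacle_def not_less)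
qed

end

theory Submission
  imports Defs
begin

text \<open>Write \<open>\<phi> = f / (f^k + \<beta>) powr (1 / k)\<close>. Its gradient is a positive multiple of
  \<open>G = \<beta> \<nabla>f - (f / k) \<nabla>\<beta>\<close>, and at critical points its Hessian is the same multiple of the
  derivative of \<open>G\<close>. Pairing \<open>G x = 0\<close> with \<open>x - x\<^sup>*\<close> shows \<open>\<beta> x = O(1 / k)\<close> for critical points
  away from \<open>x\<^sup>*\<close>, so for large \<open>k\<close> these lie close to the boundary. Close to the outer boundary there
  are none, since there \<open>\<nabla>\<beta> \<cdot> (x - x\<^sup>*) < 0\<close>. Close to an obstacle the eigenvalue condition makes the
  Hessian negative on the tangent space of the level set of \<open>\<beta>\<close>, while it is of order \<open>1 / \<beta>\<close> in the
  normal direction: such points are nondegenerate and not local minima. Near \<open>x\<^sup>*\<close> the strong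
  monotonicity of \<open>\<nabla>f\<close> allows only one critical point, and a nondegenerate one. The global minimum
  of \<open>\<phi>\<close> on the compact free space must be this point. In dimension one there is no tangent
  direction, but there connectedness of the free space excludes obstacles.\<close>

subsection \<open>Quadratic forms of symmetric matrices\<close>

text \<open>The eigenvalue condition arises as follows. At a critical point
  \<open>gB x = T gf x\<close> with the multiplier \<open>T = k \<beta> / f\<close>, and on tangent
  vectors the derivative of \<open>G\<close> is \<open>f / k\<close> times the form of
  \<open>T Hf - HB\<close>. Pairing with \<open>x - xs\<close> and strong convexity bound
  \<open>T\<close> by \<open>(gB x \<bullet> (x - xs)) / (l |x - xs|\<^sup>2)\<close>. On the
  boundary of obstacle \<open>i\<close>, up to the common positive factor contributed by the other
  \<open>b j\<close>, \<open>gB x\<close> is \<open>2 A y\<close> and \<open>HB\<close> is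
  tangentially \<open>2 A\<close>, where \<open>y = x - c i\<close>, \<open>z = xs - c i\<close>.
  Replacing \<open>Hf\<close> by \<open>lmax\<close> and \<open>A\<close> by its least eigenvalue
  \<mu>, negativity follows from \<open>lmax / lmin * (A y \<bullet> (y - z)) < \<mu> |y -
  z|\<^sup>2\<close>. The bound
  \<open>A y \<bullet> (y - z) \<le> M r / (r + d) |y - z|\<^sup>2\<close> for \<open>y\<close> on
  the ellipsoid and \<open>z\<close> outside reduces this to the assumed inequality. All of this
  lives on the boundary, whereas critical points only come close to it. The inequalities there are
  strict, so compactness gives them a fixed margin in a boundary layer whose width does not depend
  on \<open>k\<close>.\<close>

lemma symmetric_inner_matrix:
  fixes A :: "real^'n^'n"
  assumes "transpose A = A"
  shows "x \<bullet> (A *v y) = y \<bullet> (A *v x)"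
  by (metis assms dot_lmul_matrix inner_commute vector_transpose_matrix)

lemma matrix_vector_mult_uminus_left: "(- A) *v x = - (A *v (x :: real^'n))"
  for A :: "real^'n^'m"
  by (simp add: matrix_vector_mult_def vec_eq_iff sum_negf)

text \<open>The norm on \<open>real^'n^'m\<close> is the Euclidean norm of the vector of row norms,
  so Cauchy-Schwarz in each row suffices.\<close>

lemma norm_matrix_vector_mult_le: "norm (A *v x) \<le> norm A * norm x"
  for A :: "real^'n^'m"
proof -
  have "norm ((A *v x) $ i) \<le> norm ((norm x *\<^sub>R (\<chi> i. norm (A $ i))) $ i)" for i
    using Cauchy_Schwarz_ineq2[of "A $ i" x]
    by (simp add: matrix_vector_mul_component mult.commute)
  then have "norm (A *v x) \<le> norm (norm x *\<^sub>R (\<chi> i. norm (A $ i)) :: real^'m)"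
    by (rule norm_le_componentwise_cart)
  also have "\<dots> = norm x * norm A"
    by (subst norm_scaleR) (simp add: norm_vec_def)
  finally show ?thesis by (simp add: mult.commute)
qed

text \<open>The minimum \<open>c\<close> of the form on the unit sphere bounds it everywhere by
  homogeneity. Hence a minimizer \<open>v0\<close> also minimizes
  \<open>v \<bullet> (A *v v) - c * (v \<bullet> v)\<close> over the whole space, and the vanishing
  gradient there is the eigenvector equation; this replaces a Lagrange multiplier.\<close>

lemma rayleigh_min_eigenvalue:
  fixes A :: "real^'n^'n"
  assumes sym: "transpose A = A"
  shows "\<exists>c \<in> eigenvalues A. \<forall>v. c * (norm v)\<^sup>2 \<le> v \<bullet> (A *v v)"
proof -
  let ?q = "\<lambda>v. v \<bullet> (A *v v)"
  have cont: "continuous_on (sphere 0 1) ?q"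
    by (intro continuous_intros linear_continuous_on matrix_vector_mul_bounded_linear)
  have ne: "sphere 0 1 \<noteq> ({} :: (real^'n) set)"
    by simp
  obtain v0 where v0: "norm v0 = 1" "\<And>v. norm v = 1 \<Longrightarrow> ?q v0 \<le> ?q v"
    using continuous_attains_inf[OF compact_sphere ne cont] by auto
  define c where "c = ?q v0"
  have bound: "c * (norm v)\<^sup>2 \<le> ?q v" for v
  proof (cases "v = 0")
    case False
    let ?u = "(1 / norm v) *\<^sub>R v"
    have "c \<le> ?q ?u"
      unfolding c_def using False by (intro v0) simp
    also have "\<dots> = ?q v / (norm v)\<^sup>2"
      by (simp add: matrix_vector_mult_scaleR power2_eq_square)
    finally show ?thesis
      using False by (simp add: field_simps)
  qed simp
  have "((\<lambda>v. ?q v - c * (v \<bullet> v)) has_derivative (\<lambda>h. 2 * (h \<bullet> (A *v v0 - c *\<^sub>R v0)))) (at v0)"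
    by (rule has_derivative_eq_rhs, (rule derivative_intros bounded_linear_imp_has_derivative matrix_vector_mul_bounded_linear)+)
      (simp add: symmetric_inner_matrix[OF sym, of v0] fun_eq_iff algebra_simps inner_commute)
  moreover have "eventually (\<lambda>v. ?q v0 - c * (v0 \<bullet> v0) \<le> ?q v - c * (v \<bullet> v)) (at v0)"
    using bound v0(1) by (intro always_eventually) (simp add: c_def dot_square_norm)
  ultimately have "(\<lambda>h. 2 * (h \<bullet> (A *v v0 - c *\<^sub>R v0))) = (\<lambda>h. 0)"
    by (rule has_derivative_local_min)
  then have "(A *v v0 - c *\<^sub>R v0) \<bullet> (A *v v0 - c *\<^sub>R v0) = 0"
    by (metis mult_eq_0_iff zero_neq_numeral)
  then have "A *v v0 = c *\<^sub>R v0" by simp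
  then have "c \<in> eigenvalues A"
    using v0(1) by (auto simp: eigenvalues_def intro!: exI[of _ v0])
  then show ?thesis using bound by blast
qed

lemma uminus_mem_eigenvalues:
  assumes "c \<in> eigenvalues (- A)"
  shows "- c \<in> eigenvalues A"
proof -
  obtain v where "v \<noteq> 0" "- (A *v v) = c *\<^sub>R v"
    using assms by (auto simp: eigenvalues_def matrix_vector_mult_uminus_left)
  then have "A *v v = (- c) *\<^sub>R v"
    by (metis add.inverse_inverse scaleR_minus_left)
  with \<open>v \<noteq> 0\<close> show ?thesis
    unfolding eigenvalues_def by blast
qed

lemma rayleigh_max_eigenvalue:
  fixes A :: "real^'n^'n"
  assumes sym: "transpose A = A"
  shows "\<exists>c \<in> eigenvalues A. \<forall>v. v \<bullet> (A *v v) \<le> c * (norm v)\<^sup>2"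
proof -
  have "transpose (- A) = - A"
    using sym by (simp add: transpose_def vec_eq_iff)
  from rayleigh_min_eigenvalue[OF this] obtain c where
    c: "c \<in> eigenvalues (- A)" "\<And>v. c * (norm v)\<^sup>2 \<le> v \<bullet> ((- A) *v v)"
    by blast
  have "v \<bullet> (A *v v) \<le> - c * (norm v)\<^sup>2" for v
    using c(2)[of v] by (simp add: matrix_vector_mult_uminus_left)
  moreover have "- c \<in> eigenvalues A"
    using c(1) by (rule uminus_mem_eigenvalues)
  ultimately show ?thesis by blast
qed

lemma quadratic_form_bounds:
  fixes A :: "real^'n^'n"
  assumes "transpose A = A" "eigenvalues A \<subseteq> {l..u}"
  shows "l * (norm v)\<^sup>2 \<le> v \<bullet> (A *v v)" "v \<bullet> (A *v v) \<le> u * (norm v)\<^sup>2"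
proof -
  obtain a where a: "a \<in> eigenvalues A" "a * (norm v)\<^sup>2 \<le> v \<bullet> (A *v v)"
    using rayleigh_min_eigenvalue[OF assms(1)] by blast
  obtain b where b: "b \<in> eigenvalues A" "v \<bullet> (A *v v) \<le> b * (norm v)\<^sup>2"
    using rayleigh_max_eigenvalue[OF assms(1)] by blast
  have "l * (norm v)\<^sup>2 \<le> a * (norm v)\<^sup>2" "b * (norm v)\<^sup>2 \<le> u * (norm v)\<^sup>2"
    using a(1) b(1) assms(2) by (auto intro!: mult_right_mono)
  then show "l * (norm v)\<^sup>2 \<le> v \<bullet> (A *v v)" "v \<bullet> (A *v v) \<le> u * (norm v)\<^sup>2"
    using a(2) b(2) by linarith+
qed

text \<open>Makes \<open>Min\<close> and \<open>Max\<close> of the spectrum usable: eigenvectors for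
  distinct eigenvalues of a symmetric matrix are orthogonal, hence independent, and independent sets
  are finite.\<close>

lemma finite_eigenvalues:
  fixes A :: "real^'n^'n"
  assumes sym: "transpose A = A"
  shows "finite (eigenvalues A)"
proof -
  have "\<forall>c \<in> eigenvalues A. \<exists>v. v \<noteq> 0 \<and> A *v v = c *\<^sub>R v"
    by (simp add: eigenvalues_def)
  then obtain ev where ev: "\<And>c. c \<in> eigenvalues A \<Longrightarrow> ev c \<noteq> 0 \<and> A *v ev c = c *\<^sub>R ev c"
    by (metis (no_types))
  have orth: "ev a \<bullet> ev b = 0" if "a \<in> eigenvalues A" "b \<in> eigenvalues A" "a \<noteq> b" for a b
    using symmetric_inner_matrix[OF sym, of "ev a" "ev b"] ev[OF that(1)] ev[OF that(2)] that(3)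
    by (simp add: inner_commute)
  have "inj_on ev (eigenvalues A)"
    using orth ev by (intro inj_onI) (metis inner_eq_zero_iff)
  moreover have "independent (ev ` eigenvalues A)"
    using orth ev by (intro pairwise_orthogonal_independent)
      (auto simp: pairwise_def orthogonal_def)
  ultimately show ?thesis
    using independent_imp_finite finite_imageD by blast
qed

lemma min_max_eigenvalue_bounds:
  fixes A :: "real^'n^'n"
  assumes "transpose A = A"
  shows "min_eigenvalue A * (norm v)\<^sup>2 \<le> v \<bullet> (A *v v)"
    and "v \<bullet> (A *v v) \<le> max_eigenvalue A * (norm v)\<^sup>2"
proof -
  have "eigenvalues A \<subseteq> {min_eigenvalue A..max_eigenvalue A}"
    using finite_eigenvalues[OF assms] by (auto simp: min_eigenvalue_def max_eigenvalue_def)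
  from quadratic_form_bounds[OF assms this]
  show "min_eigenvalue A * (norm v)\<^sup>2 \<le> v \<bullet> (A *v v)"
    "v \<bullet> (A *v v) \<le> max_eigenvalue A * (norm v)\<^sup>2" by auto
qed

lemma min_eigenvalue_pos:
  fixes A :: "real^'n^'n"
  assumes "transpose A = A" "pos_def A"
  shows "0 < min_eigenvalue A"
proof -
  have "eigenvalues A \<noteq> {}"
    using rayleigh_min_eigenvalue[OF assms(1)] by blast
  then have "min_eigenvalue A \<in> eigenvalues A"
    unfolding min_eigenvalue_def by (intro Min_in finite_eigenvalues assms)
  then obtain v where v: "v \<noteq> 0" "A *v v = min_eigenvalue A *\<^sub>R v"
    by (auto simp: eigenvalues_def)
  then have "0 < min_eigenvalue A * (v \<bullet> v)"
    using assms(2) by (auto simp: pos_def_def dest!: spec[of _ v])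
  then show ?thesis using inner_ge_zero[of v] by (simp add: zero_less_mult_iff not_less)
qed

text \<open>With \<open>B = M \<cdot> I - A\<close> positive semidefinite, \<open>M |w|\<^sup>2 = w \<cdot> A w + w \<cdot> B w\<close>
  for \<open>w = y - z\<close>. After dropping the \<open>B\<close>-term, the claim is an inequality between \<open>p = |y|\<close> and
  \<open>q = |z|\<close> in the norm of \<open>A\<close>, and Cauchy--Schwarz for \<open>A\<close> reduces it to
  \<open>(r q - d p) (q + p) \<ge> 0\<close> if \<open>d \<ge> r\<close>, and to \<open>(q - p) (r q + d p) \<ge> 0\<close> if \<open>d \<le> r\<close>.\<close>
lemma ellipsoid_inequality:
  fixes A :: "real^'n^'n"
  assumes sym: "transpose A = A" and pd: "pos_def A"
    and bounds: "\<And>v. \<mu> * (norm v)\<^sup>2 \<le> v \<bullet> (A *v v)" "\<And>v. v \<bullet> (A *v v) \<le> M * (norm v)\<^sup>2"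
    and "\<mu> > 0" "r > 0"
    and y: "y \<bullet> (A *v y) = \<mu> * r\<^sup>2" and z: "z \<bullet> (A *v z) \<ge> \<mu> * r\<^sup>2"
  shows "(A *v y) \<bullet> (y - z) * (r + norm z) \<le> M * r * (norm (y - z))\<^sup>2"
proof -
  define d where "d = norm z"
  define p q s where "p = sqrt (y \<bullet> (A *v y))" and "q = sqrt (z \<bullet> (A *v z))"
    and "s = y \<bullet> (A *v z)"
  have nonneg: "v \<bullet> (A *v v) \<ge> 0" for v
    using pd by (cases "v = 0") (auto simp: pos_def_def less_imp_le)
  have p2: "p\<^sup>2 = y \<bullet> (A *v y)" and q2: "q\<^sup>2 = z \<bullet> (A *v z)" and pq0: "p \<ge> 0" "q \<ge> 0"
    using nonneg by (auto simp: p_def q_def)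
  have p_eq: "p = sqrt \<mu> * r"
    using \<open>\<mu> > 0\<close> \<open>r > 0\<close> by (simp add: p_def y real_sqrt_mult)
  have qd: "q \<ge> sqrt \<mu> * d"
    unfolding q_def d_def using bounds(1)[of z] \<open>\<mu> > 0\<close>
    by (metis norm_ge_zero real_sqrt_le_mono real_sqrt_mult real_sqrt_unique)
  have qp: "q \<ge> p"
    unfolding q_def p_def using y z by simp
  have p_pos: "p > 0"
    using p_eq \<open>\<mu> > 0\<close> \<open>r > 0\<close> by simp
  have exp: "(a *\<^sub>R y + e *\<^sub>R z) \<bullet> (A *v (a *\<^sub>R y + e *\<^sub>R z)) = a\<^sup>2 * p\<^sup>2 + 2 * a * e * s + e\<^sup>2 * q\<^sup>2" for a e
    using symmetric_inner_matrix[OF sym, of y z]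
    unfolding p2 q2
    by (simp add: s_def matrix_vector_right_distrib matrix_vector_mult_scaleR
        power2_eq_square algebra_simps)
  \<comment> \<open>Cauchy-Schwarz for the form of \<open>A\<close>: its values at
    \<open>q y + p z\<close> and \<open>q y - p z\<close> are \<open>2 p q (p q + s)\<close> and
    \<open>2 p q (p q - s)\<close>.\<close>
  have cs: "\<bar>s\<bar> \<le> p * q"
  proof -
    have "0 \<le> p * q * (p * q + s)" "0 \<le> p * q * (p * q - s)"
      using nonneg[of "q *\<^sub>R y + p *\<^sub>R z"] nonneg[of "q *\<^sub>R y + (- p) *\<^sub>R z"]
      unfolding exp by (auto simp: power2_eq_square algebra_simps)
    moreover have "p * q > 0"
      using p_pos qp by simp
    ultimately show ?thesis
      using zero_le_mult_iff[of "p * q" "p * q + s"] zero_le_mult_iff[of "p * q" "p * q - s"]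
      by linarith
  qed
  have w: "(y - z) \<bullet> (A *v (y - z)) = p\<^sup>2 - 2 * s + q\<^sup>2"
    using exp[of 1 "-1"] by simp
  have yw: "(A *v y) \<bullet> (y - z) = p\<^sup>2 - s"
    using symmetric_inner_matrix[OF sym, of y z]
    by (simp add: p2 s_def inner_diff_right inner_commute)
  \<comment> \<open>The claim is \<open>0 \<le> r q\<^sup>2 - d p\<^sup>2 + (d - r) s\<close>, so
    the sign of \<open>d - r\<close> decides which side of \<open>cs\<close> is used.\<close>
  have key: "(p\<^sup>2 - s) * (r + d) \<le> r * (p\<^sup>2 - 2 * s + q\<^sup>2)"
  proof (cases "d \<ge> r")
    case True
    have "r * q - d * p \<ge> 0"
      using mult_left_mono[OF qd, of r] \<open>r > 0\<close> by (simp add: p_eq algebra_simps)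
    then have "0 \<le> (r * q - d * p) * (q + p)"
      using pq0 by simp
    moreover have "(d - r) * s \<ge> (d - r) * (- (p * q))"
      using True cs by (intro mult_left_mono) auto
    ultimately show ?thesis
      by (simp add: algebra_simps power2_eq_square)
  next
    case False
    have "0 \<le> (q - p) * (r * q + d * p)"
      using qp pq0 \<open>r > 0\<close> by (simp add: d_def)
    moreover have "(r - d) * s \<le> (r - d) * (p * q)"
      using False cs by (intro mult_left_mono) auto
    ultimately show ?thesis
      by (simp add: algebra_simps power2_eq_square)
  qed
  also have "\<dots> \<le> r * (M * (norm (y - z))\<^sup>2)"
    using bounds(2)[of "y - z"] \<open>r > 0\<close> unfolding w by simp
  finally show ?thesis
    unfolding yw d_def by (simp add: algebra_simps)
qed

subsection \<open>Second-order calculus\<close>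

definition outer :: "real^'n \<Rightarrow> real^'n \<Rightarrow> real^'n^'n" where
  "outer u v = (\<chi> i j. u $ i * v $ j)"

lemma outer_mult_vec: "outer u v *v h = (h \<bullet> v) *\<^sub>R u"
  by (simp add: outer_def matrix_vector_mult_def inner_vec_def vec_eq_iff sum_distrib_left
      sum_distrib_right mult_ac)

lemma continuous_on_outer [continuous_intros]:
  assumes "continuous_on S u" "continuous_on S v"
  shows "continuous_on S (\<lambda>x. outer (u x) (v x))"
  unfolding outer_def by (intro continuous_intros assms)

lemma continuous_on_matrix_vector_mult [continuous_intros]:
  fixes A :: "'a::topological_space \<Rightarrow> real^'n^'m"
  assumes "continuous_on S A" "continuous_on S u"
  shows "continuous_on S (\<lambda>x. A x *v u x)"
  unfolding matrix_vector_mult_def by (intro continuous_intros assms)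

lemma scaleR_matrix_vector_mult: "(a *\<^sub>R A) *v x = a *\<^sub>R (A *v x)"
  for A :: "real^'n^'m"
  by (simp add: scaleR_matrix_vector_assoc)

lemma has_C2_derivs_onD:
  assumes "has_C2_derivs_on f g H S"
  shows "x \<in> S \<Longrightarrow> (f has_derivative (\<lambda>h. h \<bullet> g x)) (at x within S)"
    and "x \<in> S \<Longrightarrow> (g has_derivative (\<lambda>h. H x *v h)) (at x within S)"
    and "continuous_on S H"
  using assms by (auto simp: has_C2_derivs_on_def)

lemma has_C2_derivs_on_continuous:
  assumes "has_C2_derivs_on f g H S"
  shows "continuous_on S f" "continuous_on S g" "continuous_on S H"
  by (rule has_derivative_continuous_on[OF has_C2_derivs_onD(1)[OF assms]], assumption,
      rule has_derivative_continuous_on[OF has_C2_derivs_onD(2)[OF assms]], assumption,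
      rule has_C2_derivs_onD(3)[OF assms])

lemma has_C2_derivs_on_interior:
  assumes "has_C2_derivs_on f g H S" "x \<in> interior S"
  shows "(f has_derivative (\<lambda>h. h \<bullet> g x)) (at x)" "(g has_derivative (\<lambda>h. H x *v h)) (at x)"
proof -
  have "x \<in> S" using assms(2) interior_subset by blast
  from has_C2_derivs_onD(1,2)[OF assms(1) this]
  show "(f has_derivative (\<lambda>h. h \<bullet> g x)) (at x)" "(g has_derivative (\<lambda>h. H x *v h)) (at x)"
    by (simp_all add: at_within_interior[OF assms(2)])
qed

lemma has_C2_derivs_on_subset:
  assumes "has_C2_derivs_on f g H S" "T \<subseteq> S"
  shows "has_C2_derivs_on f g H T"
  unfolding has_C2_derivs_on_def
proof (intro conjI ballI)
  fix x assume "x \<in> T"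
  then have "x \<in> S" using assms(2) by blast
  note d = has_C2_derivs_onD(1,2)[OF assms(1) this]
  show "(f has_derivative (\<lambda>h. h \<bullet> g x)) (at x within T)"
    by (rule has_derivative_subset[OF d(1) assms(2)])
  show "(g has_derivative (\<lambda>h. H x *v h)) (at x within T)"
    by (rule has_derivative_subset[OF d(2) assms(2)])
next
  show "continuous_on T H"
    by (rule continuous_on_subset[OF has_C2_derivs_onD(3)[OF assms(1)] assms(2)])
qed

lemma has_C2_derivs_on_cong:
  assumes "has_C2_derivs_on f g H S" "\<And>x. x \<in> S \<Longrightarrow> g x = g' x"
  shows "has_C2_derivs_on f g' H S"
  unfolding has_C2_derivs_on_def
proof (intro conjI ballI)
  fix x assume x: "x \<in> S"
  show "(f has_derivative (\<lambda>h. h \<bullet> g' x)) (at x within S)"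
    using has_C2_derivs_onD(1)[OF assms(1) x] assms(2)[OF x] by simp
  show "(g' has_derivative (\<lambda>h. H x *v h)) (at x within S)"
    by (rule has_derivative_transform[OF x _ has_C2_derivs_onD(2)[OF assms(1) x]])
      (simp add: assms(2))
qed (rule has_C2_derivs_onD(3)[OF assms(1)])

lemma has_C2_derivs_on_const: "has_C2_derivs_on (\<lambda>x. a) (\<lambda>x. 0) (\<lambda>x. 0) S"
  by (simp add: has_C2_derivs_on_def)

lemma has_C2_derivs_on_add:
  assumes "has_C2_derivs_on f g H S" "has_C2_derivs_on f' g' H' S"
  shows "has_C2_derivs_on (\<lambda>x. f x + f' x) (\<lambda>x. g x + g' x) (\<lambda>x. H x + H' x) S"
  unfolding has_C2_derivs_on_def inner_add_right matrix_vector_mult_add_rdistrib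
  by (intro conjI ballI has_derivative_add continuous_on_add has_C2_derivs_onD[OF assms(1)]
      has_C2_derivs_onD[OF assms(2)])

lemma has_C2_derivs_on_mult:
  assumes 1: "has_C2_derivs_on f g H S" and 2: "has_C2_derivs_on f' g' H' S"
  shows "has_C2_derivs_on (\<lambda>x. f x * f' x) (\<lambda>x. f x *\<^sub>R g' x + f' x *\<^sub>R g x)
    (\<lambda>x. f x *\<^sub>R H' x + f' x *\<^sub>R H x + outer (g' x) (g x) + outer (g x) (g' x)) S"
  unfolding has_C2_derivs_on_def
proof (intro conjI ballI)
  fix x assume x: "x \<in> S"
  note d = has_C2_derivs_onD(1,2)[OF 1 x] has_C2_derivs_onD(1,2)[OF 2 x]
  show "((\<lambda>x. f x * f' x) has_derivative (\<lambda>h. h \<bullet> (f x *\<^sub>R g' x + f' x *\<^sub>R g x))) (at x within S)"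
    by (rule has_derivative_eq_rhs[OF has_derivative_mult[OF d(1,3)]])
      (simp add: algebra_simps fun_eq_iff)
  show "((\<lambda>x. f x *\<^sub>R g' x + f' x *\<^sub>R g x) has_derivative
      (*v) (f x *\<^sub>R H' x + f' x *\<^sub>R H x + outer (g' x) (g x) + outer (g x) (g' x))) (at x within S)"
    by (rule has_derivative_eq_rhs[OF has_derivative_add[OF
          has_derivative_scaleR[OF d(1,4)] has_derivative_scaleR[OF d(3,2)]]])
      (simp add: fun_eq_iff outer_mult_vec matrix_vector_mult_add_rdistrib scaleR_matrix_vector_mult)
next
  show "continuous_on S (\<lambda>x. f x *\<^sub>R H' x + f' x *\<^sub>R H x + outer (g' x) (g x) + outer (g x) (g' x))"
    using has_C2_derivs_on_continuous[OF 1] has_C2_derivs_on_continuous[OF 2]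
    by (intro continuous_intros)
qed

text \<open>The outer function is differentiated only within \<open>T\<close>, so that
  \<open>t powr k\<close> on \<open>{0..}\<close> is covered; its argument, the objective, may
  vanish at its minimizer.\<close>

lemma has_C2_derivs_on_compose:
  fixes \<phi> \<phi>' \<phi>'' :: "real \<Rightarrow> real"
  assumes f: "has_C2_derivs_on f g H S"
    and \<phi>: "\<And>t. t \<in> T \<Longrightarrow> (\<phi> has_real_derivative \<phi>' t) (at t within T)"
    and \<phi>': "\<And>t. t \<in> T \<Longrightarrow> (\<phi>' has_real_derivative \<phi>'' t) (at t within T)"
    and cont: "continuous_on T \<phi>''" and img: "f ` S \<subseteq> T"
  shows "has_C2_derivs_on (\<lambda>x. \<phi> (f x)) (\<lambda>x. \<phi>' (f x) *\<^sub>R g x)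
    (\<lambda>x. \<phi>'' (f x) *\<^sub>R outer (g x) (g x) + \<phi>' (f x) *\<^sub>R H x) S"
  unfolding has_C2_derivs_on_def
proof (intro conjI ballI)
  fix x assume x: "x \<in> S"
  note d = has_C2_derivs_onD(1,2)[OF f x]
  have c1: "((\<lambda>x. \<phi> (f x)) has_derivative (\<lambda>h. \<phi>' (f x) * (h \<bullet> g x))) (at x within S)"
    using \<phi> by (intro has_derivative_in_compose2[OF _ img x d(1)])
      (auto simp: has_field_derivative_def)
  have c2: "((\<lambda>x. \<phi>' (f x)) has_derivative (\<lambda>h. \<phi>'' (f x) * (h \<bullet> g x))) (at x within S)"
    using \<phi>' by (intro has_derivative_in_compose2[OF _ img x d(1)])
      (auto simp: has_field_derivative_def)
  show "((\<lambda>x. \<phi> (f x)) has_derivative (\<lambda>h. h \<bullet> \<phi>' (f x) *\<^sub>R g x)) (at x within S)"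
    using c1 by simp
  show "((\<lambda>x. \<phi>' (f x) *\<^sub>R g x) has_derivative
      (*v) (\<phi>'' (f x) *\<^sub>R outer (g x) (g x) + \<phi>' (f x) *\<^sub>R H x)) (at x within S)"
    by (rule has_derivative_eq_rhs[OF has_derivative_scaleR[OF c2 d(2)]])
      (simp add: fun_eq_iff outer_mult_vec matrix_vector_mult_add_rdistrib scaleR_matrix_vector_mult)
next
  have "continuous_on T \<phi>'"
    using \<phi>' by (meson DERIV_continuous continuous_on_eq_continuous_within)
  then have "continuous_on S (\<lambda>x. \<phi>' (f x))" "continuous_on S (\<lambda>x. \<phi>'' (f x))"
    using cont img has_C2_derivs_on_continuous(1)[OF f]
    by (auto intro: continuous_on_compose2)
  then show "continuous_on S (\<lambda>x. \<phi>'' (f x) *\<^sub>R outer (g x) (g x) + \<phi>' (f x) *\<^sub>R H x)"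
    using has_C2_derivs_on_continuous[OF f] by (intro continuous_intros)
qed

text \<open>The derivatives of \<open>total_beta\<close> are obtained only existentially; uniqueness
  allows computing them at a boundary point from whichever factorization is convenient
  there.\<close>

lemma has_C2_derivs_on_unique:
  assumes 1: "has_C2_derivs_on f g H UNIV" and 2: "has_C2_derivs_on f g' H' UNIV"
  shows "g = g'" "H = H'"
proof -
  show g: "g = g'"
  proof
    fix x
    have "(\<lambda>h. h \<bullet> g x) = (\<lambda>h. h \<bullet> g' x)"
      using has_C2_derivs_onD(1)[OF 1, of x] has_C2_derivs_onD(1)[OF 2, of x]
      by (auto intro: has_derivative_unique)
    then show "g x = g' x" by (metis vector_eq_ldot)
  qed
  show "H = H'"
  proof
    fix x
    have "(\<lambda>h. H x *v h) = (\<lambda>h. H' x *v h)"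
      using has_C2_derivs_onD(2)[OF 1, of x] has_C2_derivs_onD(2)[OF 2, of x]
      unfolding g by (auto intro: has_derivative_unique)
    then show "H x = H' x" by (metis matrix_eq)
  qed
qed

text \<open>At the endpoint 0 the difference quotient is \<open>t powr (k - 1)\<close>, which tends
  to 0 because \<open>k > 1\<close>.\<close>

lemma has_real_derivative_powr_nonneg:
  fixes k :: real
  assumes "k > 1" "t \<in> {0..}"
  shows "((\<lambda>t. t powr k) has_real_derivative k * t powr (k - 1)) (at t within {0..})"
proof (cases "t = 0")
  case False
  then show ?thesis
    using assms by (auto intro!: derivative_eq_intros)
next
  case True
  have "continuous_on {0::real..} (\<lambda>t. t powr (k - 1))"
    using assms by (intro continuous_on_powr') (auto intro!: continuous_intros)
  then have "((\<lambda>t. t powr (k - 1)) \<longlongrightarrow> 0) (at (0::real) within {0..})"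
    using assms by (auto simp: continuous_on_def dest!: bspec[of _ _ 0])
  moreover have "eventually (\<lambda>t. t powr (k - 1) = t powr k / t) (at (0::real) within {0..})"
    by (auto simp: eventually_at_filter powr_diff)
  ultimately have "((\<lambda>t. t powr k / t) \<longlongrightarrow> 0) (at (0::real) within {0..})"
    by (rule Lim_transform_eventually)
  then show ?thesis
    using True assms by (simp add: has_field_derivative_iff)
qed

section \<open>Mean values on segments, symmetry of the Hessian, second-order conditions\<close>

lemma mvt_segment:
  fixes f :: "'a::real_normed_vector \<Rightarrow> real"
  assumes "convex S" and xy: "x \<in> S" "y \<in> S"
    and f: "\<And>z. z \<in> S \<Longrightarrow> (f has_derivative f' z) (at z within S)"
  shows "\<exists>t\<in>{0<..<1}. f y - f x = f' (x + t *\<^sub>R (y - x)) (y - x)"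
proof -
  have in_S: "x + t *\<^sub>R (y - x) \<in> S" if "t \<in> {0..1}" for t
    using convexD_alt[OF \<open>convex S\<close> xy, of t] that by (simp add: algebra_simps)
  have "\<exists>t\<in>{0<..<1::real}. f (x + 1 *\<^sub>R (y - x)) - f (x + 0 *\<^sub>R (y - x))
      = f' (x + t *\<^sub>R (y - x)) ((1 - 0) *\<^sub>R (y - x))"
  proof (rule mvt_simple)
    fix t :: real assume "0 \<le> t" "t \<le> 1"
    then show "((\<lambda>t. f (x + t *\<^sub>R (y - x))) has_derivative
        (\<lambda>s. f' (x + t *\<^sub>R (y - x)) (s *\<^sub>R (y - x)))) (at t within {0..1})"
      using in_S by (intro has_derivative_in_compose2[OF f, where s = "{0..1}"])
        (auto intro!: derivative_eq_intros)
  qed simp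
  then show ?thesis by simp
qed

text \<open>A vector-valued map satisfies no mean value equation, but its pairing with a fixed
  \<open>w\<close> does.\<close>

lemma gradient_mvt:
  fixes u :: "real^'n \<Rightarrow> real^'n"
  assumes "convex S" "x \<in> S" "y \<in> S"
    and u: "\<And>z. z \<in> S \<Longrightarrow> (u has_derivative M z) (at z within S)"
  shows "\<exists>t\<in>{0<..<1}. (u y - u x) \<bullet> w = M (x + t *\<^sub>R (y - x)) (y - x) \<bullet> w"
  using mvt_segment[OF assms(1-3), of "\<lambda>z. u z \<bullet> w" "\<lambda>z h. M z h \<bullet> w"]
    has_derivative_inner_left[OF u] by (auto simp: inner_diff_left)

text \<open>For Schwarz's theorem: both \<open>u \<cdot> H v\<close> and \<open>v \<cdot> H u\<close> are limits of the second differences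
  \<open>f (x + t u + t v) - f (x + t u) - f (x + t v) + f x\<close> divided by \<open>t\<^sup>2\<close>.\<close>
lemma second_difference:
  fixes f :: "real^'n \<Rightarrow> real"
  assumes f: "has_C2_derivs_on f g H (ball x e)" and "0 < t" "t * (norm u + norm v) < e"
  shows "\<exists>z \<in> cball x (t * (norm u + norm v)).
    f (x + t *\<^sub>R u + t *\<^sub>R v) - f (x + t *\<^sub>R u) - f (x + t *\<^sub>R v) + f x = t\<^sup>2 * (u \<bullet> (H z *v v))"
proof -
  have nu: "norm (a *\<^sub>R u + b *\<^sub>R v) \<le> t * (norm u + norm v)" if "0 \<le> a" "a \<le> t" "0 \<le> b" "b \<le> t" for a b
  proof -
    have "norm (a *\<^sub>R u + b *\<^sub>R v) \<le> a * norm u + b * norm v"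
      using norm_triangle_ineq[of "a *\<^sub>R u" "b *\<^sub>R v"] that by simp
    also have "\<dots> \<le> t * norm u + t * norm v"
      using that by (intro add_mono mult_right_mono) auto
    finally show ?thesis by (simp add: algebra_simps)
  qed
  have dist_x: "dist x (x + a *\<^sub>R u + b *\<^sub>R v) = norm (a *\<^sub>R u + b *\<^sub>R v)" for a b
  proof -
    have "x - (x + a *\<^sub>R u + b *\<^sub>R v) = - (a *\<^sub>R u + b *\<^sub>R v)" by simp
    then show ?thesis
      by (metis dist_norm norm_minus_cancel)
  qed
  have inb: "x + a *\<^sub>R u + b *\<^sub>R v \<in> ball x e" if "0 \<le> a" "a \<le> t" "0 \<le> b" "b \<le> t" for a b
  proof -
    show ?thesis using nu[OF that] assms(3) by (simp add: dist_x)
  qed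
  have d: "(f has_derivative (\<lambda>h. h \<bullet> g z)) (at z)" if "z \<in> ball x e" for z
    using has_C2_derivs_on_interior(1)[OF f] that by (simp add: interior_open)
  let ?\<phi> = "\<lambda>s. f (x + s *\<^sub>R u + t *\<^sub>R v) - f (x + s *\<^sub>R u)"
  have "\<exists>s\<in>{0<..<t}. ?\<phi> t - ?\<phi> 0 = (t - 0) * (u \<bullet> (g (x + s *\<^sub>R u + t *\<^sub>R v) - g (x + s *\<^sub>R u)))"
  proof (rule mvt_simple[OF \<open>0 < t\<close>])
    fix s assume s: "0 \<le> s" "s \<le> t"
    have "((\<lambda>s. f (x + s *\<^sub>R u + t *\<^sub>R v)) has_derivative (\<lambda>h. h *\<^sub>R u \<bullet> g (x + s *\<^sub>R u + t *\<^sub>R v)))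
        (at s within {0..t})"
      using inb[of s t] s \<open>0 < t\<close>
      by (intro has_derivative_compose[OF _ d]) (auto intro!: derivative_eq_intros)
    moreover have "((\<lambda>s. f (x + s *\<^sub>R u)) has_derivative (\<lambda>h. h *\<^sub>R u \<bullet> g (x + s *\<^sub>R u)))
        (at s within {0..t})"
      using inb[of s 0] s \<open>0 < t\<close>
      by (intro has_derivative_compose[OF _ d]) (auto intro!: derivative_eq_intros)
    ultimately show "(?\<phi> has_derivative (\<lambda>h. h * (u \<bullet> (g (x + s *\<^sub>R u + t *\<^sub>R v) - g (x + s *\<^sub>R u)))))
        (at s within {0..t})"
      by (rule has_derivative_eq_rhs[OF has_derivative_diff])
        (simp add: fun_eq_iff algebra_simps)
  qed
  then obtain s where s: "s \<in> {0<..<t}"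
    and 1: "?\<phi> t - ?\<phi> 0 = t * (u \<bullet> (g (x + s *\<^sub>R u + t *\<^sub>R v) - g (x + s *\<^sub>R u)))"
    by auto
  obtain \<tau> where \<tau>: "\<tau> \<in> {0<..<1}"
    and 2: "(g (x + s *\<^sub>R u + t *\<^sub>R v) - g (x + s *\<^sub>R u)) \<bullet> u
      = (H (x + s *\<^sub>R u + \<tau> *\<^sub>R (t *\<^sub>R v)) *v (t *\<^sub>R v)) \<bullet> u"
    using gradient_mvt[OF convex_ball[of x e], of "x + s *\<^sub>R u" "x + s *\<^sub>R u + t *\<^sub>R v" g
        "\<lambda>z h. H z *v h" u] inb[of s 0] inb[of s t] s has_C2_derivs_onD(2)[OF f] by auto
  show ?thesis
  proof (rule bexI)
    show "f (x + t *\<^sub>R u + t *\<^sub>R v) - f (x + t *\<^sub>R u) - f (x + t *\<^sub>R v) + f x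
        = t\<^sup>2 * (u \<bullet> (H (x + s *\<^sub>R u + \<tau> *\<^sub>R (t *\<^sub>R v)) *v v))"
    proof -
      have "u \<bullet> (g (x + s *\<^sub>R u + t *\<^sub>R v) - g (x + s *\<^sub>R u))
          = t * (u \<bullet> (H (x + s *\<^sub>R u + \<tau> *\<^sub>R (t *\<^sub>R v)) *v v))"
        by (subst inner_commute, subst 2)
          (simp only: matrix_vector_mult_scaleR inner_scaleR_left inner_commute[of u])
      with 1 show ?thesis by (simp add: power2_eq_square)
    qed
    show "x + s *\<^sub>R u + \<tau> *\<^sub>R (t *\<^sub>R v) \<in> cball x (t * (norm u + norm v))"
      using nu[of s "\<tau> * t"] s \<tau> dist_x[of s "\<tau> * t"] by (simp add: mult_le_cancel_right1)
  qed
qed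

text \<open>Needed because the hypotheses on \<open>hess_f0\<close> concern eigenvalues, which
  control the quadratic form only of a symmetric matrix. The second difference is symmetric in
  \<open>u\<close> and \<open>v\<close>, so the two Hessian values it produces agree for every step
  \<open>t n\<close>, and continuity of \<open>H\<close> carries this to the limit.\<close>

lemma hessian_symmetric:
  fixes f :: "real^'n \<Rightarrow> real"
  assumes f: "has_C2_derivs_on f g H S" and x: "x \<in> interior S"
  shows "transpose (H x) = H x"
proof -
  obtain e where e: "e > 0" "ball x e \<subseteq> S"
    using x mem_interior by blast
  have fe: "has_C2_derivs_on f g H (ball x e)"
    using has_C2_derivs_on_subset[OF f e(2)] .
  have eq: "u \<bullet> (H x *v v) = v \<bullet> (H x *v u)" for u v
  proof -
    \<comment> \<open>The \<open>+ 1\<close> keeps \<open>R\<close> positive for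
      \<open>u = v = 0\<close> and makes the inequality \<open>t n * (norm u + norm v) < e\<close>
      strict.\<close>
    define R where "R = norm u + norm v + 1"
    have R: "R > 0" unfolding R_def by (smt (verit) norm_ge_zero)
    define t where "t n = e / (R * real (n + 2))" for n
    have t: "0 < t n" "t n * (norm u + norm v) < e" for n
    proof -
      show "0 < t n" using e R by (simp add: t_def)
      have "t n * (norm u + norm v) < t n * R"
        using \<open>0 < t n\<close> by (simp add: R_def)
      also have "\<dots> = e / real (n + 2)" using R by (simp add: t_def)
      also have "\<dots> \<le> e" using e by (simp add: field_simps)
      finally show "t n * (norm u + norm v) < e" .
    qed
    have "\<forall>n. \<exists>z w. z \<in> cball x (t n * (norm u + norm v)) \<and> w \<in> cball x (t n * (norm u + norm v))
        \<and> u \<bullet> (H z *v v) = v \<bullet> (H w *v u)"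
    proof
      fix n
      obtain z where z: "z \<in> cball x (t n * (norm u + norm v))"
        "f (x + t n *\<^sub>R u + t n *\<^sub>R v) - f (x + t n *\<^sub>R u) - f (x + t n *\<^sub>R v) + f x
          = (t n)\<^sup>2 * (u \<bullet> (H z *v v))"
        using second_difference[OF fe t] by blast
      have "t n * (norm v + norm u) < e"
        using t(2)[of n] by (simp add: add.commute)
      then obtain w where w: "w \<in> cball x (t n * (norm v + norm u))"
        "f (x + t n *\<^sub>R v + t n *\<^sub>R u) - f (x + t n *\<^sub>R v) - f (x + t n *\<^sub>R u) + f x
          = (t n)\<^sup>2 * (v \<bullet> (H w *v u))"
        using second_difference[OF fe t(1)] by blast
      have swap: "x + t n *\<^sub>R v + t n *\<^sub>R u = x + t n *\<^sub>R u + t n *\<^sub>R v" by simp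
      have "(t n)\<^sup>2 * (u \<bullet> (H z *v v)) = (t n)\<^sup>2 * (v \<bullet> (H w *v u))"
        using z(2) w(2)[unfolded swap] by linarith
      then have "u \<bullet> (H z *v v) = v \<bullet> (H w *v u)"
        using t(1)[of n] by simp
      then show "\<exists>z w. z \<in> cball x (t n * (norm u + norm v)) \<and> w \<in> cball x (t n * (norm u + norm v))
        \<and> u \<bullet> (H z *v v) = v \<bullet> (H w *v u)"
        using z(1) w(1)[unfolded add.commute[of "norm v"]] by blast
    qed
    then obtain z w where z: "\<And>n. z n \<in> cball x (t n * (norm u + norm v))"
      and w: "\<And>n. w n \<in> cball x (t n * (norm u + norm v))"
      and zw: "\<And>n. u \<bullet> (H (z n) *v v) = v \<bullet> (H (w n) *v u)"
      by metis
    have t0: "(\<lambda>n. t n * (norm u + norm v)) \<longlonglongrightarrow> 0"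
    proof -
      have "(\<lambda>n. e / R * (norm u + norm v) * (1 / real (n + 2))) \<longlonglongrightarrow> e / R * (norm u + norm v) * 0"
        by (intro tendsto_mult_left LIMSEQ_ignore_initial_segment[OF lim_1_over_n])
      then show ?thesis by (simp add: t_def field_simps)
    qed
    have lim: "y \<longlonglongrightarrow> x" if "\<And>n. y n \<in> cball x (t n * (norm u + norm v))" for y
    proof -
      have "(\<lambda>n. dist (y n) x) \<longlonglongrightarrow> 0"
        by (rule tendsto_sandwich[OF always_eventually always_eventually tendsto_const t0])
          (use that in \<open>simp_all add: dist_commute[of _ x]\<close>)
      then show ?thesis by (rule iffD2[OF tendsto_dist_iff])
    qed
    have Hc: "(\<lambda>n. H (y n)) \<longlonglongrightarrow> H x" if "y \<longlonglongrightarrow> x" for y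
    proof -
      have "isCont H x"
        using has_C2_derivs_onD(3)[OF fe] e(1) by (simp add: continuous_on_eq_continuous_at)
      then show ?thesis using that by (rule isCont_tendsto_compose)
    qed
    have Hq: "(\<lambda>n. a \<bullet> (H (y n) *v b)) \<longlonglongrightarrow> a \<bullet> (H x *v b)" if "y \<longlonglongrightarrow> x" for y a b
      unfolding matrix_vector_mult_def using Hc[OF that]
      by (intro tendsto_intros)
    show ?thesis
      using Hq[OF lim[OF z], of u v] Hq[OF lim[OF w], of v u] unfolding zw
      by (rule LIMSEQ_unique)
  qed
  have "transpose (H x) *v v = H x *v v" for v
  proof -
    have "u \<bullet> (transpose (H x) *v v) = u \<bullet> (H x *v v)" for u
      using eq[of u v] by (simp add: dot_lmul_matrix inner_commute[of u])
    then show ?thesis by (metis vector_eq_ldot)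
  qed
  then show ?thesis by (simp add: matrix_eq)
qed

lemma local_min_on_interior:
  fixes \<phi> :: "real^'n \<Rightarrow> real"
  assumes \<phi>: "has_C2_derivs_on \<phi> g H F" and x: "x \<in> interior F" and min: "local_min_on F \<phi> x"
  shows "g x = 0" "0 \<le> v \<bullet> (H x *v v)"
proof -
  obtain e0 where e0: "e0 > 0" "ball x e0 \<subseteq> F"
    using x mem_interior by blast
  obtain e1 where e1: "e1 > 0" "\<And>y. y \<in> F \<inter> ball x e1 \<Longrightarrow> \<phi> x \<le> \<phi> y"
    using min by (auto simp: local_min_on_def)
  show g0: "g x = 0"
  proof -
    have "(\<lambda>h. h \<bullet> g x) = (\<lambda>v. 0)"
      using e0 e1 by (intro differential_zero_maxmin[OF _ _ has_C2_derivs_on_interior(1)[OF \<phi> x],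
            where S = "ball x (min e0 e1)"]) auto
    then show ?thesis by (metis inner_eq_zero_iff)
  qed
  show "0 \<le> v \<bullet> (H x *v v)"
  proof (rule ccontr)
    assume neg: "\<not> 0 \<le> v \<bullet> (H x *v v)"
    then have v: "v \<noteq> 0" by auto
    have "continuous_on (ball x e0) (\<lambda>z. v \<bullet> (H z *v v))"
      using has_C2_derivs_onD(3)[OF \<phi>] e0(2)
      by (intro continuous_intros) (rule continuous_on_subset)
    then have "isCont (\<lambda>z. v \<bullet> (H z *v v)) x"
      using e0(1) by (simp add: continuous_on_eq_continuous_at)
    then have "eventually (\<lambda>z. v \<bullet> (H z *v v) < 0) (at x)"
      using neg unfolding isCont_def by (intro order_tendstoD(2)) auto
    then obtain e2 where "e2 > 0" "\<And>z. z \<noteq> x \<Longrightarrow> dist z x < e2 \<Longrightarrow> v \<bullet> (H z *v v) < 0"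
      by (auto simp: eventually_at)
    then have e2: "e2 > 0" "\<And>z. dist z x < e2 \<Longrightarrow> v \<bullet> (H z *v v) < 0"
      using neg by (auto simp: not_le) (metis not_le)
    define e where "e = min e0 (min e1 e2)"
    define B where "B = ball x e"
    have e: "e > 0" and B: "B \<subseteq> F" "convex B" "x \<in> B"
      using e0 e1 e2 by (auto simp: e_def B_def)
    define y where "y = x + (e / (2 * norm v)) *\<^sub>R v"
    have y: "y \<in> B"
      using e v by (simp add: B_def y_def dist_norm)
    note \<phi>B = has_C2_derivs_on_subset[OF \<phi> B(1)]
    obtain t where t: "t \<in> {0<..<1}"
      and 1: "\<phi> y - \<phi> x = (y - x) \<bullet> g (x + t *\<^sub>R (y - x))"
      using mvt_segment[OF B(2,3) y has_C2_derivs_onD(1)[OF \<phi>B]] by auto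
    have z: "x + t *\<^sub>R (y - x) \<in> B" (is "?z \<in> B")
      using convexD_alt[OF B(2,3) y, of t] t by (simp add: algebra_simps)
    \<comment> \<open>A second mean value replaces Taylor's formula: since \<open>g x = 0\<close>,
      the gradient at \<open>?z\<close> becomes a Hessian applied to \<open>?z - x\<close>, which is
      \<open>t\<close> times \<open>y - x\<close>.\<close>
    obtain s where s: "s \<in> {0<..<1}"
      and 2: "(g ?z - g x) \<bullet> (y - x) = (H (x + s *\<^sub>R (?z - x)) *v (?z - x)) \<bullet> (y - x)"
      using gradient_mvt[OF B(2,3) z has_C2_derivs_onD(2)[OF \<phi>B]] by blast
    have w: "x + s *\<^sub>R (?z - x) \<in> B" (is "?w \<in> B")
      using convexD_alt[OF B(2,3) z, of s] s by (simp add: algebra_simps)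
    have "\<phi> y - \<phi> x = (e / (2 * norm v))\<^sup>2 * t * (v \<bullet> (H ?w *v v))"
      using 1 2 g0 by (simp add: y_def matrix_vector_mult_scaleR power2_eq_square inner_commute)
    also have "\<dots> < 0"
      using e2(2)[of ?w] w t v e by (intro mult_pos_neg) (auto simp: B_def e_def dist_commute)
    finally show False
      using e1(2)[of y] y B(1) by (auto simp: B_def e_def)
  qed
qed

text \<open>Serves in both directions: decrease of \<beta> shows that its zeros are not interior to
  the free space, and increase of \<beta> shows that a boundary point, where the potential has its
  largest value 1, is no local minimum.\<close>

lemma gradient_nonzero_increase_decrease:
  fixes f :: "'a::real_inner \<Rightarrow> real"
  assumes "(f has_derivative (\<lambda>h. h \<bullet> g)) (at x)" "g \<noteq> 0" "e > 0"
  shows "\<exists>y \<in> ball x e. f x < f y" "\<exists>y \<in> ball x e. f y < f x"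
proof -
  have *: "\<exists>y \<in> ball x e. f y < f x"
    if f: "(f has_derivative (\<lambda>h. h \<bullet> g)) (at x)" and "g \<noteq> 0" for f :: "'a \<Rightarrow> real" and g
  proof (rule ccontr)
    assume "\<not> ?thesis"
    then have "(\<lambda>h. h \<bullet> g) = (\<lambda>v. 0)"
      using \<open>e > 0\<close> by (intro differential_zero_maxmin[OF _ _ f, where S = "ball x e"]) (auto simp: not_less)
    then show False using \<open>g \<noteq> 0\<close> by (metis inner_eq_zero_iff)
  qed
  show "\<exists>y \<in> ball x e. f y < f x"
    using *[OF assms(1,2)] .
  have "((\<lambda>y. - f y) has_derivative (\<lambda>h. h \<bullet> (- g))) (at x)"
    using has_derivative_minus[OF assms(1)] by simp
  from *[OF this] show "\<exists>y \<in> ball x e. f x < f y"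
    using assms(2) by simp
qed

subsection \<open>The potential\<close>

text \<open>Turns a strict inequality on a compact set into a margin independent of the point, and
  hence of \<open>k\<close>.\<close>

lemma compact_continuous_pos_bound:
  fixes h :: "'a::topological_space \<Rightarrow> real"
  assumes "compact S" "continuous_on S h" "\<And>x. x \<in> S \<Longrightarrow> 0 < h x"
  shows "\<exists>d>0. \<forall>x\<in>S. d \<le> h x"
proof (cases "S = {}")
  case False
  then obtain x where "x \<in> S" "\<forall>y\<in>S. h x \<le> h y"
    using continuous_attains_inf[OF assms(1) _ assms(2)] by blast
  then show ?thesis using assms(3) by blast
qed (auto intro: exI[of _ 1])

lemma compact_continuous_bound:
  fixes h :: "'a::topological_space \<Rightarrow> real"
  assumes "compact S" "continuous_on S h"
  shows "\<exists>C. \<forall>x\<in>S. h x \<le> C"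
proof (cases "S = {}")
  case False
  then show ?thesis
    using continuous_attains_sup[OF assms(1) _ assms(2)] by blast
qed auto

text \<open>Splitting \<open>w = \<sigma> n + v\<close> along \<open>n = g / |g|\<close>, the \<open>v\<close>-component of the equation gives
  \<open>c |v| \<le> C |\<sigma>|\<close>, and then the \<open>n\<close>-component forces \<open>\<sigma> = 0\<close>.\<close>
lemma rank_one_perturbation_kernel:
  fixes M :: "'a::real_inner \<Rightarrow> 'a"
  assumes M: "linear M" "\<And>w. norm (M w) \<le> C * norm w"
    and neg: "\<And>v. v \<bullet> g = 0 \<Longrightarrow> v \<bullet> M v \<le> - c * (norm v)\<^sup>2"
    and "g \<noteq> 0" "c > 0" "C > 0" and a: "a * (norm g)\<^sup>2 > C + C\<^sup>2 / c"
    and ker: "M w + (a * (w \<bullet> g)) *\<^sub>R g = 0"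
  shows "w = 0"
proof -
  define n where "n = (1 / norm g) *\<^sub>R g"
  define \<sigma> where "\<sigma> = w \<bullet> n"
  define v where "v = w - \<sigma> *\<^sub>R n"
  have n: "norm n = 1" "g = norm g *\<^sub>R n"
    using \<open>g \<noteq> 0\<close> by (auto simp: n_def)
  have nn: "n \<bullet> n = 1" using n(1) by (simp add: dot_square_norm)
  have vn: "v \<bullet> n = 0"
    by (simp add: v_def inner_diff_left nn \<sigma>_def)
  have vg: "v \<bullet> g = 0"
    by (subst n(2)) (simp add: vn)
  have w: "w = \<sigma> *\<^sub>R n + v" by (simp add: v_def)
  have wg: "w \<bullet> g = norm g * \<sigma>"
    by (subst n(2)) (simp add: \<sigma>_def)
  have Mw: "M w = \<sigma> *\<^sub>R M n + M v"
    using M(1) by (subst w) (simp add: linear_add linear_cmul)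
  have Mn: "norm (M n) \<le> C" using M(2)[of n] n(1) by simp
  have "0 = v \<bullet> (M w + (a * (w \<bullet> g)) *\<^sub>R g)" unfolding ker by simp
  also have "\<dots> = \<sigma> * (v \<bullet> M n) + v \<bullet> M v"
    by (simp add: Mw inner_add_right vg)
  finally have "c * (norm v)\<^sup>2 \<le> \<sigma> * (v \<bullet> M n)"
    using neg[OF vg] by simp
  also have "\<dots> \<le> \<bar>\<sigma>\<bar> * (norm v * C)"
  proof -
    have "\<bar>v \<bullet> M n\<bar> \<le> norm v * C"
      using Cauchy_Schwarz_ineq2[of v "M n"] mult_left_mono[OF Mn, of "norm v"] by simp
    then have "\<bar>\<sigma>\<bar> * \<bar>v \<bullet> M n\<bar> \<le> \<bar>\<sigma>\<bar> * (norm v * C)"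
      by (intro mult_left_mono) auto
    then show ?thesis by (metis abs_le_D1 abs_mult)
  qed
  finally have "norm v * (c * norm v) \<le> norm v * (C * \<bar>\<sigma>\<bar>)"
    by (simp add: power2_eq_square mult_ac)
  then have v: "norm v \<le> C / c * \<bar>\<sigma>\<bar>"
    using \<open>c > 0\<close> \<open>C > 0\<close> by (cases "v = 0") (auto simp: field_simps)
  have "0 = n \<bullet> (M w + (a * (w \<bullet> g)) *\<^sub>R g)" unfolding ker by simp
  also have "\<dots> = n \<bullet> M w + a * (norm g)\<^sup>2 * \<sigma>"
  proof -
    have "n \<bullet> g = norm g" by (subst n(2)) (simp add: nn)
    then show ?thesis by (simp add: inner_add_right wg power2_eq_square)
  qed
  finally have "a * (norm g)\<^sup>2 * \<sigma> = - (n \<bullet> M w)" by simp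
  then have "\<bar>a * (norm g)\<^sup>2 * \<sigma>\<bar> \<le> norm (M w)"
    using Cauchy_Schwarz_ineq2[of n "M w"] n(1) by simp
  moreover have "a * (norm g)\<^sup>2 * \<bar>\<sigma>\<bar> \<le> \<bar>a * (norm g)\<^sup>2 * \<sigma>\<bar>"
    by (metis abs_ge_self abs_mult abs_mult_self_eq mult.commute mult_left_mono abs_ge_zero)
  \<comment> \<open>This is the origin of the threshold \<open>C + C\<^sup>2 / c\<close>:
    \<open>M\<close> costs a factor \<open>C\<close>, and \<open>norm w\<close> is at most
    \<open>1 + C / c\<close> times the size of the normal component.\<close>
  moreover have "norm (M w) \<le> C * (\<bar>\<sigma>\<bar> + C / c * \<bar>\<sigma>\<bar>)"
  proof -
    have "norm w \<le> \<bar>\<sigma>\<bar> + norm v"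
      unfolding w using norm_triangle_ineq[of "\<sigma> *\<^sub>R n" v] n(1) by simp
    then have "C * norm w \<le> C * (\<bar>\<sigma>\<bar> + C / c * \<bar>\<sigma>\<bar>)"
      using v \<open>C > 0\<close> by (intro mult_left_mono) auto
    then show ?thesis using M(2)[of w] by linarith
  qed
  ultimately have "(a * (norm g)\<^sup>2 - (C + C\<^sup>2 / c)) * \<bar>\<sigma>\<bar> \<le> 0"
    by (simp add: algebra_simps power2_eq_square)
  then have "\<sigma> = 0"
    using a by (simp add: mult_le_0_iff)
  with v w show ?thesis by simp
qed

lemma C2_lipschitz:
  fixes f :: "real^'n \<Rightarrow> real"
  assumes f: "has_C2_derivs_on f g H S" and S: "convex S" "x \<in> S" "y \<in> S"
    and C: "\<And>z. z \<in> S \<Longrightarrow> norm (g z) \<le> C" "\<And>z. z \<in> S \<Longrightarrow> norm (H z) \<le> C"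
  shows "\<bar>f y - f x\<bar> \<le> C * norm (y - x)" "norm (g y - g x) \<le> C * norm (y - x)"
proof -
  have seg: "x + t *\<^sub>R (y - x) \<in> S" if "t \<in> {0<..<1}" for t
    using convexD_alt[OF S, of t] that by (simp add: algebra_simps)
  obtain t where t: "t \<in> {0<..<1}" "f y - f x = (y - x) \<bullet> g (x + t *\<^sub>R (y - x))"
    using mvt_segment[OF S has_C2_derivs_onD(1)[OF f]] by blast
  have "\<bar>f y - f x\<bar> \<le> norm (y - x) * norm (g (x + t *\<^sub>R (y - x)))"
    unfolding t(2) by (rule Cauchy_Schwarz_ineq2)
  also have "\<dots> \<le> norm (y - x) * C"
    using C(1)[OF seg[OF t(1)]] by (intro mult_left_mono) auto
  finally show "\<bar>f y - f x\<bar> \<le> C * norm (y - x)" by (simp add: mult.commute)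
  \<comment> \<open>Pairing the gradient difference with itself recovers a norm bound from the
    scalar mean value equation.\<close>
  let ?d = "g y - g x"
  obtain s where s: "s \<in> {0<..<1}"
    "?d \<bullet> ?d = (H (x + s *\<^sub>R (y - x)) *v (y - x)) \<bullet> ?d"
    using gradient_mvt[OF S has_C2_derivs_onD(2)[OF f]] by blast
  have "norm ?d * norm ?d \<le> norm (H (x + s *\<^sub>R (y - x)) *v (y - x)) * norm ?d"
    using norm_cauchy_schwarz[of "H (x + s *\<^sub>R (y - x)) *v (y - x)" ?d]
    by (simp add: s(2)[symmetric] dot_square_norm power2_eq_square)
  then have "norm ?d \<le> norm (H (x + s *\<^sub>R (y - x)) *v (y - x)) \<or> ?d = 0"
    by (metis mult_le_cancel_right_pos zero_less_norm_iff)
  moreover have "norm (H (x + s *\<^sub>R (y - x)) *v (y - x)) \<le> C * norm (y - x)"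
    by (rule order_trans[OF norm_matrix_vector_mult_le mult_right_mono[OF C(2)[OF seg[OF s(1)]]]]) simp
  moreover have "0 \<le> C" using C(1)[OF S(2)] norm_ge_zero order_trans by blast
  ultimately show "norm (g y - g x) \<le> C * norm (y - x)" by auto
qed

text \<open>The properties of \<open>\<beta>\<close> and \<open>f\<close> on which the theorem rests. The condition \<open>saddle\<close> says that,
  at a boundary point which can be a limit of critical points as \<open>k \<rightarrow> \<infinity>\<close> (there
  \<open>\<nabla>\<beta> \<cdot> (x - x\<^sup>*) \<ge> 0\<close>), the tangential Hessian of the potential is negative.\<close>
locale koditschek_rimon_potential =
  fixes f \<beta> :: "real^'n \<Rightarrow> real" and gf gB :: "real^'n \<Rightarrow> real^'n" and Hf HB :: "real^'n \<Rightarrow> real^'n^'n"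
    and F :: "(real^'n) set" and xs :: "real^'n" and l u :: real
  assumes F_eq: "F = {x. 0 \<le> \<beta> x}" and F_compact: "compact F"
    and \<beta>_C2: "has_C2_derivs_on \<beta> gB HB UNIV"
    and f_C2: "has_C2_derivs_on f gf Hf F"
    and f_nonneg: "x \<in> F \<Longrightarrow> 0 \<le> f x"
    and f_pos: "x \<in> F \<Longrightarrow> x \<noteq> xs \<Longrightarrow> 0 < f x"
    and \<beta>_xs: "0 < \<beta> xs" and gf_xs: "gf xs = 0"
    and l_pos: "0 < l"
    and gf_radial: "x \<in> F \<Longrightarrow> l * (norm (x - xs))\<^sup>2 \<le> gf x \<bullet> (x - xs)"
    and Hf_lower: "0 < \<beta> x \<Longrightarrow> l * (norm v)\<^sup>2 \<le> v \<bullet> (Hf x *v v)"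
    and Hf_upper: "0 < \<beta> x \<Longrightarrow> v \<bullet> (Hf x *v v) \<le> u * (norm v)\<^sup>2"
    and gB_nonzero: "\<beta> x = 0 \<Longrightarrow> gB x \<noteq> 0"
    and saddle: "\<beta> x = 0 \<Longrightarrow> norm v = 1 \<Longrightarrow> gB x \<bullet> v = 0 \<Longrightarrow> gB x \<bullet> (x - xs) < 0 \<or>
      0 < (norm (x - xs))\<^sup>2 * (v \<bullet> (HB x *v v)) - u / l * (gB x \<bullet> (x - xs))"
    and dim: "2 \<le> CARD('n) \<or> (\<forall>x. \<beta> x = 0 \<longrightarrow> gB x \<bullet> (x - xs) < 0)"
begin

definition q :: "real \<Rightarrow> real^'n \<Rightarrow> real" where
  "q k x = f x powr k + \<beta> x"

definition \<phi> :: "real \<Rightarrow> real^'n \<Rightarrow> real" where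
  "\<phi> k x = f x / (q k x powr (1 / k))"

text \<open>The positive factor between \<open>G\<close> and the gradient of the potential; the
  exponent comes from differentiating \<open>q powr (- 1 / k)\<close>.\<close>

definition \<sigma> :: "real \<Rightarrow> real^'n \<Rightarrow> real" where
  "\<sigma> k x = q k x powr (- 1 / k - 1)"

definition G :: "real \<Rightarrow> real^'n \<Rightarrow> real^'n" where
  "G k x = \<beta> x *\<^sub>R gf x - (f x / k) *\<^sub>R gB x"

text \<open>The derivative of \<open>G k\<close> at \<open>x\<close> in direction \<open>h\<close>.
  At interior critical points \<open>gf x\<close> is a multiple of \<open>gB x\<close>, so the first
  and third summands merge into a rank-one term in \<open>gB x\<close>.\<close>

definition DG :: "real \<Rightarrow> real^'n \<Rightarrow> real^'n \<Rightarrow> real^'n" where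
  "DG k x h = (h \<bullet> gB x) *\<^sub>R gf x + \<beta> x *\<^sub>R (Hf x *v h)
     - ((h \<bullet> gf x) / k) *\<^sub>R gB x - (f x / k) *\<^sub>R (HB x *v h)"

lemma mem_F: "x \<in> F \<longleftrightarrow> 0 \<le> \<beta> x"
  by (simp add: F_eq)

lemma \<beta>_C2_F: "has_C2_derivs_on \<beta> gB HB F"
  by (rule has_C2_derivs_on_subset[OF \<beta>_C2]) simp

lemma \<beta>_has_derivative: "(\<beta> has_derivative (\<lambda>h. h \<bullet> gB x)) (at x)"
  using has_C2_derivs_onD(1)[OF \<beta>_C2, of x] by simp

lemma interior_F: "interior F = {x. 0 < \<beta> x}"
proof (rule subset_antisym)
  show "{x. 0 < \<beta> x} \<subseteq> interior F"
  proof (rule interior_maximal)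
    show "open {x. 0 < \<beta> x}"
      using has_C2_derivs_on_continuous(1)[OF \<beta>_C2] by (intro open_Collect_less) auto
  qed (auto simp: F_eq)
  show "interior F \<subseteq> {x. 0 < \<beta> x}"
  proof
    fix x assume x: "x \<in> interior F"
    then obtain e where e: "e > 0" "ball x e \<subseteq> F"
      using mem_interior by blast
    have "\<beta> x \<ge> 0" using e centre_in_ball[of x e] mem_F by blast
    moreover have "\<beta> x \<noteq> 0"
    proof
      assume 0: "\<beta> x = 0"
      obtain y where "y \<in> ball x e" "\<beta> y < \<beta> x"
        using gradient_nonzero_increase_decrease(2)[OF \<beta>_has_derivative gB_nonzero[OF 0] e(1)] by blast
      then show False using 0 e(2) mem_F[of y] by auto
    qed
    ultimately show "x \<in> {x. 0 < \<beta> x}" by simp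
  qed
qed

lemma frontier_F: "frontier F = {x. \<beta> x = 0}"
  using compact_imp_closed[OF F_compact] by (auto simp: frontier_def interior_F mem_F)

text \<open>The two summands never vanish together: \<open>f\<close> can vanish only at
  \<open>xs\<close>, where \<beta> is positive.\<close>

lemma q_pos: "0 < q k x" if "x \<in> F"
proof (cases "x = xs")
  case True
  then show ?thesis using \<beta>_xs by (simp add: q_def add_nonneg_pos)
next
  case False
  then show ?thesis using f_pos[OF that False] that by (simp add: q_def mem_F add_pos_nonneg)
qed

lemma \<phi>_nonneg: "0 \<le> \<phi> k x" if "x \<in> F"
  using f_nonneg[OF that] by (simp add: \<phi>_def)

lemma \<phi>_le_1: "\<phi> k x \<le> 1" and \<phi>_eq_1_iff: "\<phi> k x = 1 \<longleftrightarrow> \<beta> x = 0" if "x \<in> F" "k > 0"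
proof -
  have f_eq: "f x = (f x powr k) powr (1 / k)"
    using f_nonneg[OF that(1)] that(2) by (simp add: powr_powr)
  have pos: "0 < q k x powr (1 / k)" using q_pos[OF that(1), of k] by simp
  have "f x \<le> q k x powr (1 / k)"
    using that by (subst f_eq, intro powr_mono2) (auto simp: q_def mem_F)
  then show "\<phi> k x \<le> 1" using pos by (simp add: \<phi>_def)
  have "f x < q k x powr (1 / k)" if "\<beta> x \<noteq> 0"
    using that \<open>x \<in> F\<close> \<open>k > 0\<close> by (subst f_eq, intro powr_less_mono2) (auto simp: q_def mem_F)
  moreover have "f x = q k x powr (1 / k)" if "\<beta> x = 0"
    using f_eq that by (simp add: q_def)
  ultimately show "\<phi> k x = 1 \<longleftrightarrow> \<beta> x = 0"
    using pos by (cases "\<beta> x = 0") (auto simp: \<phi>_def)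
qed

lemma \<sigma>_pos: "0 < \<sigma> k x" if "x \<in> F"
  using q_pos[OF that, of k] by (simp add: \<sigma>_def)

text \<open>With \<open>k > 2\<close> the second derivative of \<open>t powr k\<close> has a
  positive exponent and so stays continuous at 0, a value that \<open>f\<close> may take at
  \<open>xs\<close>.\<close>

lemma q_C2:
  assumes "k > 2"
  shows "\<exists>H. has_C2_derivs_on (q k) (\<lambda>x. (k * f x powr (k - 1)) *\<^sub>R gf x + gB x) H F"
proof -
  have c: "continuous_on {0..} (\<lambda>t::real. k * ((k - 1) * t powr (k - 1 - 1)))"
    using assms by (intro continuous_intros continuous_on_powr') auto
  have d: "((\<lambda>t. k * t powr (k - 1)) has_real_derivative k * ((k - 1) * t powr (k - 1 - 1)))
      (at t within {0..})" if "t \<in> {0..}" for t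
    using assms that by (intro DERIV_cmult has_real_derivative_powr_nonneg) auto
  have p: "((\<lambda>t. t powr k) has_real_derivative k * t powr (k - 1)) (at t within {0..})"
    if "t \<in> {0..}" for t
    using assms that by (intro has_real_derivative_powr_nonneg) auto
  have "f ` F \<subseteq> {0..}" using f_nonneg by auto
  from has_C2_derivs_on_compose[OF f_C2 p d c this]
obtain H where "has_C2_derivs_on (\<lambda>x. f x powr k) (\<lambda>x. (k * f x powr (k - 1)) *\<^sub>R gf x) H F"
    by blast
  from has_C2_derivs_on_add[OF this \<beta>_C2_F] show ?thesis
    unfolding q_def[abs_def] by blast
qed

text \<open>The exponent is left free because both \<open>- 1 / k\<close>, for the potential, and
  \<open>- 1 / k - 1\<close>, for \<open>\<sigma>\<close>, are needed.\<close>

lemma q_powr_C2: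
  assumes "k > 2"
  shows "\<exists>H. has_C2_derivs_on (\<lambda>x. q k x powr a)
    (\<lambda>x. (a * q k x powr (a - 1)) *\<^sub>R ((k * f x powr (k - 1)) *\<^sub>R gf x + gB x)) H F"
proof -
  obtain H where H: "has_C2_derivs_on (q k) (\<lambda>x. (k * f x powr (k - 1)) *\<^sub>R gf x + gB x) H F"
    using q_C2[OF assms] by blast
  have p: "((\<lambda>t. t powr a) has_real_derivative a * t powr (a - 1)) (at t within {0<..})"
    if "t \<in> {0<..}" for a t :: real
    using that by (intro has_field_derivative_at_within[OF has_real_derivative_powr]) auto
  have d: "((\<lambda>t. a * t powr (a - 1)) has_real_derivative a * ((a - 1) * t powr (a - 1 - 1)))
      (at t within {0<..})" if "t \<in> {0<..}" for t :: real
    by (intro DERIV_cmult p that)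
  have c: "continuous_on {0<..} (\<lambda>t::real. a * ((a - 1) * t powr (a - 1 - 1)))"
    by (intro continuous_intros) auto
  have "q k ` F \<subseteq> {0<..}" using q_pos by auto
  from has_C2_derivs_on_compose[OF H p d c this] show ?thesis by blast
qed

lemma \<phi>_C2:
  assumes "k > 2"
  shows "\<exists>H. has_C2_derivs_on (\<phi> k) (\<lambda>x. \<sigma> k x *\<^sub>R G k x) H F"
proof -
  have \<phi>_eq: "\<phi> k = (\<lambda>x. f x * q k x powr (- 1 / k))"
    by (simp add: \<phi>_def fun_eq_iff powr_minus divide_inverse)
  obtain H where H: "has_C2_derivs_on (\<lambda>x. q k x powr (- 1 / k))
    (\<lambda>x. ((- 1 / k) * q k x powr (- 1 / k - 1)) *\<^sub>R ((k * f x powr (k - 1)) *\<^sub>R gf x + gB x)) H F"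
    using q_powr_C2[OF assms] by blast
  have grad: "f x *\<^sub>R (((- 1 / k) * q k x powr (- 1 / k - 1)) *\<^sub>R ((k * f x powr (k - 1)) *\<^sub>R gf x + gB x))
      + q k x powr (- 1 / k) *\<^sub>R gf x = \<sigma> k x *\<^sub>R G k x" if x: "x \<in> F" for x
  proof -
    \<comment> \<open>Factoring out \<open>\<sigma>\<close> leaves \<open>q\<close> times
      \<open>gf\<close>, whose part \<open>f powr k\<close> cancels against the derivative of
      \<open>f powr k\<close> inside \<open>q\<close>. What remains is \<open>G\<close>.\<close>
    have "q k x powr (- 1 / k) = \<sigma> k x * q k x"
      using q_pos[OF x, of k] by (simp add: \<sigma>_def powr_diff)
    also have "\<dots> = \<sigma> k x * (f x * f x powr (k - 1) + \<beta> x)"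
      using f_nonneg[OF x] assms by (cases "f x = 0") (auto simp: q_def powr_diff)
    finally have 1: "q k x powr (- 1 / k) = \<sigma> k x * (f x * f x powr (k - 1) + \<beta> x)" .
    show ?thesis
      unfolding 1 \<sigma>_def[symmetric] using assms
      by (simp add: G_def algebra_simps)
  qed
  show ?thesis
    unfolding \<phi>_eq
    using has_C2_derivs_on_cong[OF has_C2_derivs_on_mult[OF f_C2 H] grad] by blast
qed

text \<open>In the product rule for \<open>\<sigma> G\<close> the derivative of
  \<open>\<sigma>\<close> is multiplied by \<open>G k x = 0\<close>. Uniqueness of the derivative
  then identifies \<open>H x\<close>, so no explicit formula for the Hessian is ever
  required.\<close>

lemma \<phi>_hessian_at_critical:
  assumes "k > 2" and H: "has_C2_derivs_on (\<phi> k) (\<lambda>x. \<sigma> k x *\<^sub>R G k x) H F"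
    and x: "0 < \<beta> x" and crit: "G k x = 0"
  shows "H x *v h = \<sigma> k x *\<^sub>R DG k x h"
proof -
  have xi: "x \<in> interior F" using x by (simp add: interior_F)
  obtain g' H' where "has_C2_derivs_on (\<lambda>x. q k x powr (- 1 / k - 1)) g' H' F"
    using q_powr_C2[OF assms(1)] by blast
  from has_C2_derivs_on_interior(1)[OF this xi]
  have \<sigma>': "(\<sigma> k has_derivative (\<lambda>h. h \<bullet> g' x)) (at x)"
    unfolding \<sigma>_def[abs_def] .
  note f' = has_C2_derivs_on_interior[OF f_C2 xi] and \<beta>' = has_C2_derivs_on_interior[OF \<beta>_C2_F xi]
  have G': "(G k has_derivative DG k x) (at x)"
    unfolding G_def[abs_def]
    by (rule has_derivative_eq_rhs[OF has_derivative_diff[OF has_derivative_scaleR[OF \<beta>'(1) f'(2)]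
          has_derivative_scaleR[OF bounded_linear.has_derivative[OF bounded_linear_divide f'(1)] \<beta>'(2)]]])
      (simp add: DG_def fun_eq_iff algebra_simps)
  have "((\<lambda>x. \<sigma> k x *\<^sub>R G k x) has_derivative (\<lambda>h. \<sigma> k x *\<^sub>R DG k x h)) (at x)"
    by (rule has_derivative_eq_rhs[OF has_derivative_scaleR[OF \<sigma>' G']]) (simp add: crit)
  from has_derivative_unique[OF has_C2_derivs_on_interior(2)[OF H xi] this]
  show ?thesis by metis
qed

section \<open>Constants valid on the whole free space or in a boundary layer\<close>

lemma uniform_bound:
  "\<exists>C\<ge>1. \<forall>x\<in>F. f x \<le> C \<and> \<beta> x \<le> C \<and> norm (gf x) \<le> C \<and> norm (gB x) \<le> C \<and> norm (Hf x) \<le> C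
     \<and> norm (HB x) \<le> C \<and> norm (x - xs) \<le> C"
proof -
  let ?N = "\<lambda>x. \<bar>f x\<bar> + \<bar>\<beta> x\<bar> + norm (gf x) + norm (gB x) + norm (Hf x) + norm (HB x) + norm (x - xs)"
  have "continuous_on F ?N"
    using has_C2_derivs_on_continuous[OF f_C2] has_C2_derivs_on_continuous[OF \<beta>_C2_F]
    by (intro continuous_intros)
  then obtain C where C: "\<And>x. x \<in> F \<Longrightarrow> ?N x \<le> C"
    using compact_continuous_bound[OF F_compact] by blast
  show ?thesis
  proof (intro exI[of _ "max 1 C"] conjI ballI)
    fix x assume "x \<in> F"
    note C[OF this] norm_ge_zero[of "gf x"] norm_ge_zero[of "gB x"] norm_ge_zero[of "Hf x"]
      norm_ge_zero[of "HB x"] norm_ge_zero[of "x - xs"] abs_ge_zero[of "f x"] abs_ge_zero[of "\<beta> x"]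
      abs_ge_self[of "f x"] abs_ge_self[of "\<beta> x"]
    then show "f x \<le> max 1 C" "\<beta> x \<le> max 1 C" "norm (gf x) \<le> max 1 C" "norm (gB x) \<le> max 1 C"
      "norm (Hf x) \<le> max 1 C" "norm (HB x) \<le> max 1 C" "norm (x - xs) \<le> max 1 C"
      by linarith+
  qed simp
qed

lemma u_pos: "0 < u"
proof -
  obtain v :: "real^'n" where v: "norm v = 1" using vector_choose_size[of 1] by auto
  show ?thesis
    using Hf_lower[OF \<beta>_xs, of v] Hf_upper[OF \<beta>_xs, of v] v l_pos by simp
qed

text \<open>The alternatives in \<open>saddle\<close>, together with the failure of its premises,
  are encoded as positivity of one maximum on \<open>F \<times> sphere 0 1\<close>. Let
  \<open>d\<close> be a positive lower bound of it: under the stated premises the other three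
  entries are below \<open>d\<close>, so the remaining one must reach \<open>d\<close>. The next two
  lemmas use the same device.\<close>

lemma saddle_uniform:
  "\<exists>d>0. \<forall>x\<in>F. \<forall>v. \<beta> x < d \<longrightarrow> norm v = 1 \<longrightarrow> gB x \<bullet> v = 0 \<longrightarrow> 0 \<le> gB x \<bullet> (x - xs) \<longrightarrow>
     d \<le> (norm (x - xs))\<^sup>2 * (v \<bullet> (HB x *v v)) - u / l * (gB x \<bullet> (x - xs))"
proof -
  let ?h = "\<lambda>x v. (norm (x - xs))\<^sup>2 * (v \<bullet> (HB x *v v)) - u / l * (gB x \<bullet> (x - xs))"
  let ?m = "\<lambda>z. max (max (\<beta> (fst z)) \<bar>gB (fst z) \<bullet> snd z\<bar>)
    (max (?h (fst z) (snd z)) (- (gB (fst z) \<bullet> (fst z - xs))))"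
  have fst: "continuous_on (F \<times> sphere 0 1) (\<lambda>z. k (fst z))" if "continuous_on F k"
    for k :: "real^'n \<Rightarrow> 'b::topological_space"
    by (rule continuous_on_compose2[OF that continuous_on_fst[OF continuous_on_id]]) auto
  have "continuous_on (F \<times> sphere 0 1) ?m"
    by (intro continuous_intros fst has_C2_derivs_on_continuous[OF \<beta>_C2_F])
  moreover have "0 < ?m z" if z: "z \<in> F \<times> sphere 0 1" for z
  proof (rule ccontr)
    assume "\<not> 0 < ?m z"
    then have le: "\<beta> (fst z) \<le> 0" "\<bar>gB (fst z) \<bullet> snd z\<bar> \<le> 0" "?h (fst z) (snd z) \<le> 0"
      "0 \<le> gB (fst z) \<bullet> (fst z - xs)" by (auto simp: not_less)
    have "\<beta> (fst z) = 0" using le(1) z by (auto simp: mem_F)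
    from saddle[OF this, of "snd z"] show False
      using z le by auto
  qed
  ultimately obtain d where d: "d > 0" "\<And>z. z \<in> F \<times> sphere 0 1 \<Longrightarrow> d \<le> ?m z"
    using compact_continuous_pos_bound[OF compact_Times[OF F_compact compact_sphere]] by blast
  have "d \<le> ?h x v" if "x \<in> F" "\<beta> x < d" "norm v = 1" "gB x \<bullet> v = 0" "0 \<le> gB x \<bullet> (x - xs)" for x v
    using d(2)[of "(x, v)"] d(1) that by (auto simp: le_max_iff_disj)
  then show ?thesis using d(1) by blast
qed

lemma gB_bound_below: "\<exists>d>0. \<forall>x\<in>F. \<beta> x < d \<longrightarrow> d \<le> norm (gB x)"
proof -
  have "continuous_on F (\<lambda>x. max (\<beta> x) (norm (gB x)))"
    by (intro continuous_intros has_C2_derivs_on_continuous[OF \<beta>_C2_F])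
  moreover have "0 < max (\<beta> x) (norm (gB x))" if "x \<in> F" for x
    using that gB_nonzero[of x] by (cases "\<beta> x = 0") (auto simp: mem_F less_max_iff_disj)
  ultimately obtain d where "d > 0" "\<And>x. x \<in> F \<Longrightarrow> d \<le> max (\<beta> x) (norm (gB x))"
    using compact_continuous_pos_bound[OF F_compact] by blast
  then show ?thesis by (intro exI[of _ d]) (auto simp: le_max_iff_disj not_less[symmetric])
qed

text \<open>Critical points near the boundary satisfy
  \<open>0 \<le> gB x \<bullet> (x - xs)\<close>, so where they can occur a nonzero tangent vector
  exists.\<close>

lemma dim_uniform: "\<exists>d>0. \<forall>x\<in>F. \<beta> x < d \<longrightarrow> 0 \<le> gB x \<bullet> (x - xs) \<longrightarrow> 2 \<le> CARD('n)"
proof (cases "2 \<le> CARD('n)")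
  case False
  have "continuous_on F (\<lambda>x. max (\<beta> x) (- (gB x \<bullet> (x - xs))))"
    by (intro continuous_intros has_C2_derivs_on_continuous[OF \<beta>_C2_F])
  moreover have "0 < max (\<beta> x) (- (gB x \<bullet> (x - xs)))" if "x \<in> F" for x
    using that dim False by (cases "\<beta> x = 0") (auto simp: mem_F less_max_iff_disj)
  ultimately obtain d where d: "d > 0" "\<And>x. x \<in> F \<Longrightarrow> d \<le> max (\<beta> x) (- (gB x \<bullet> (x - xs)))"
    using compact_continuous_pos_bound[OF F_compact] by blast
  have False if "x \<in> F" "\<beta> x < d" "0 \<le> gB x \<bullet> (x - xs)" for x
    using d(2)[OF that(1)] d(1) that by (auto simp: le_max_iff_disj)
  then show ?thesis using d(1) by blast
qed (auto intro: exI[of _ 1])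

end

subsection \<open>Critical points of the potential\<close>

context koditschek_rimon_potential
begin

lemma far_critical_points:
  assumes \<rho>: "0 < \<rho>"
  shows "\<exists>K. \<forall>k>K. \<forall>x. 0 < \<beta> x \<longrightarrow> \<rho> \<le> norm (x - xs) \<longrightarrow> G k x = 0 \<longrightarrow>
    (\<forall>w. DG k x w = 0 \<longrightarrow> w = 0) \<and> (\<exists>v. v \<bullet> DG k x v < 0)"
proof -
  obtain C where C1: "C \<ge> 1" and C: "\<And>x. x \<in> F \<Longrightarrow> f x \<le> C" "\<And>x. x \<in> F \<Longrightarrow> norm (gB x) \<le> C"
    "\<And>x. x \<in> F \<Longrightarrow> norm (Hf x) \<le> C" "\<And>x. x \<in> F \<Longrightarrow> norm (HB x) \<le> C"
    "\<And>x. x \<in> F \<Longrightarrow> norm (x - xs) \<le> C"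
    using uniform_bound by blast
  obtain d1 where d1: "d1 > 0"
    "\<And>x v. x \<in> F \<Longrightarrow> \<beta> x < d1 \<Longrightarrow> norm v = 1 \<Longrightarrow> gB x \<bullet> v = 0 \<Longrightarrow> 0 \<le> gB x \<bullet> (x - xs) \<Longrightarrow>
     d1 \<le> (norm (x - xs))\<^sup>2 * (v \<bullet> (HB x *v v)) - u / l * (gB x \<bullet> (x - xs))"
    using saddle_uniform by blast
  obtain d2 where d2: "d2 > 0" "\<And>x. x \<in> F \<Longrightarrow> \<beta> x < d2 \<Longrightarrow> d2 \<le> norm (gB x)"
    using gB_bound_below by blast
  obtain d3 where d3: "d3 > 0"
    "\<And>x. x \<in> F \<Longrightarrow> \<beta> x < d3 \<Longrightarrow> 0 \<le> gB x \<bullet> (x - xs) \<Longrightarrow> 2 \<le> CARD('n)"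
    using dim_uniform by blast
  \<comment> \<open>\<open>T0\<close> bounds the multiplier \<open>T\<close>; \<open>B\<close>
    bounds the operator \<open>M = T Hf - HB\<close>, and \<open>- c\<close> bounds its form on unit
    tangent vectors. \<open>E\<close> is the threshold of
    \<open>rank_one_perturbation_kernel\<close> for these values, and \<open>\<eta>\<close> is the
    width of a boundary layer in which all margins hold and the rank-one term exceeds
    \<open>E\<close>.\<close>
  define c where "c = d1 / C\<^sup>2"
  define T0 where "T0 = C\<^sup>2 / (l * \<rho>\<^sup>2)"
  define B where "B = T0 * C + C"
  define E where "E = B + B\<^sup>2 / c"
  define \<eta> where "\<eta> = min (min d1 d2) (min d3 (d2\<^sup>2 / (2 * E)))"
  have pos: "c > 0" "T0 > 0" "B > 0" "E > 0"
  proof -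
    show "c > 0" "T0 > 0" using d1 C1 l_pos \<rho> by (auto simp: c_def T0_def)
    then show "B > 0" using C1 by (simp add: B_def add_pos_pos)
    then show "E > 0" using \<open>c > 0\<close> by (simp add: E_def add_pos_pos)
  qed
  have \<eta>: "\<eta> > 0" using d1(1) d2(1) d3(1) pos by (simp add: \<eta>_def)
  show ?thesis
  proof (rule exI[of _ "max 2 (T0 * C / \<eta>)"], intro allI impI)
    fix k x
    assume k: "max 2 (T0 * C / \<eta>) < k" and x: "0 < \<beta> x" "\<rho> \<le> norm (x - xs)" and crit: "G k x = 0"
    have k2: "k > 2" and k\<eta>: "T0 * C < \<eta> * k"
      using k \<eta> by (auto simp: field_simps)
    have xF: "x \<in> F" using x by (simp add: mem_F)
    have "x \<noteq> xs" using x(2) \<rho> by auto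
    then have fx: "f x > 0" using f_pos[OF xF] by simp
    define N2 where "N2 = (norm (x - xs))\<^sup>2"
    have N2: "N2 \<ge> \<rho>\<^sup>2" "N2 > 0" "N2 \<le> C\<^sup>2"
      using x(2) \<rho> C(5)[OF xF] \<open>x \<noteq> xs\<close> by (auto simp: N2_def power_mono)
    define T where "T = k * \<beta> x / f x"
    have T: "T > 0" using k2 x fx by (simp add: T_def)
    have \<beta>T: "\<beta> x = T * f x / k" using fx k2 by (simp add: T_def)
    have gB_eq: "gB x = T *\<^sub>R gf x"
    proof -
      have "(f x / k) *\<^sub>R gB x = \<beta> x *\<^sub>R gf x" using crit by (simp add: G_def)
      then have "(k / f x) *\<^sub>R ((f x / k) *\<^sub>R gB x) = (k / f x) *\<^sub>R (\<beta> x *\<^sub>R gf x)" by simp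
      then show ?thesis using fx k2 by (simp add: T_def)
    qed
    \<comment> \<open>Used three times: it gives the sign of \<open>gB x \<bullet> (x - xs)\<close>,
      the bound \<open>T \<le> T0\<close>, and, in \<open>neg1\<close>, the comparison of
      \<open>T u\<close> with \<open>u / l * (gB x \<bullet> (x - xs))\<close>.\<close>
    have radial: "T * l * N2 \<le> gB x \<bullet> (x - xs)"
      using mult_left_mono[OF gf_radial[OF xF], of T] T by (simp add: gB_eq N2_def)
    then have gBx: "0 \<le> gB x \<bullet> (x - xs)"
      using T l_pos N2(2) by (smt (verit) mult_pos_pos)
    have "gB x \<bullet> (x - xs) \<le> C * C"
      by (rule order_trans[OF norm_cauchy_schwarz mult_mono[OF C(2)[OF xF] C(5)[OF xF]]]) (use C1 in auto)
    moreover have "T * l * \<rho>\<^sup>2 \<le> T * l * N2"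
      using N2(1) T l_pos by (intro mult_left_mono) auto
    ultimately have "T * (l * \<rho>\<^sup>2) \<le> C\<^sup>2"
      using radial by (simp add: power2_eq_square mult_ac)
    then have T0: "T \<le> T0"
      using l_pos \<rho> by (simp add: T0_def pos_le_divide_eq)
    \<comment> \<open>Since \<open>\<beta> x = T * f x / k\<close>, this bound and
      \<open>k > T0 * C / \<eta>\<close> put \<open>x\<close> into the boundary layer.\<close>
    have "T * f x \<le> T0 * C"
      using T0 C(1)[OF xF] T fx pos by (intro mult_mono) auto
    then have "\<beta> x < \<eta>"
      using k\<eta> k2 by (simp add: \<beta>T field_simps)
    then have \<beta>_small: "\<beta> x < d1" "\<beta> x < d2" "\<beta> x < d3" "\<beta> x < d2\<^sup>2 / (2 * E)"
      by (auto simp: \<eta>_def)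
    define M where "M w = T *\<^sub>R (Hf x *v w) - HB x *v w" for w
    have linM: "linear M"
      unfolding M_def
      by (intro linear_compose_sub linear_compose_scale_right matrix_vector_mul_linear)
    have normM: "norm (M w) \<le> B * norm w" for w
    proof -
      have 1: "norm (Hf x *v w) \<le> C * norm w"
        by (rule order_trans[OF norm_matrix_vector_mult_le mult_right_mono[OF C(3)[OF xF]]]) simp
      have 2: "norm (HB x *v w) \<le> C * norm w"
        by (rule order_trans[OF norm_matrix_vector_mult_le mult_right_mono[OF C(4)[OF xF]]]) simp
      have "norm (M w) \<le> T * norm (Hf x *v w) + norm (HB x *v w)"
        unfolding M_def using norm_triangle_ineq4[of "T *\<^sub>R (Hf x *v w)" "HB x *v w"] T by simp
      also have "\<dots> \<le> T0 * (C * norm w) + C * norm w"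
        using 1 2 T0 T pos by (intro add_mono mult_mono) auto
      finally show ?thesis by (simp add: B_def algebra_simps)
    qed
    have neg1: "e \<bullet> M e \<le> - c" if e: "norm e = 1" "gB x \<bullet> e = 0" for e
    proof -
      let ?b = "e \<bullet> (HB x *v e)"
      have "d1 \<le> N2 * ?b - u / l * (gB x \<bullet> (x - xs))"
        unfolding N2_def by (rule d1(2)[OF xF \<beta>_small(1) e gBx])
      moreover have "u / l * (T * l * N2) \<le> u / l * (gB x \<bullet> (x - xs))"
        using u_pos l_pos by (intro mult_left_mono[OF radial]) auto
      moreover have "u / l * (T * l * N2) = N2 * (T * u)"
        using l_pos by simp
      moreover have "e \<bullet> M e \<le> T * u - ?b"
        using mult_left_mono[OF Hf_upper[OF x(1), of e], of T] T e(1)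
        by (simp add: M_def inner_diff_right)
      then have "N2 * (e \<bullet> M e) \<le> N2 * (T * u) - N2 * ?b"
        using N2(2) by (simp add: right_diff_distrib[symmetric])
      ultimately have 1: "N2 * (e \<bullet> M e) \<le> - d1" by linarith
      then have "e \<bullet> M e < 0"
        using d1(1) N2(2) by (smt (verit) mult_nonneg_nonneg)
      then have "C\<^sup>2 * (e \<bullet> M e) \<le> N2 * (e \<bullet> M e)"
        using N2(3) by (intro mult_right_mono_neg) auto
      with 1 have "C\<^sup>2 * (e \<bullet> M e) \<le> - d1" by linarith
      then show ?thesis using C1 by (simp add: c_def field_simps)
    qed
    have neg: "v \<bullet> M v \<le> - c * (norm v)\<^sup>2" if v: "v \<bullet> gB x = 0" for v
    proof (cases "v = 0")
      case False
      let ?e = "(1 / norm v) *\<^sub>R v"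
      have "norm ?e = 1" "gB x \<bullet> ?e = 0" using False v by (auto simp: inner_commute)
      from neg1[OF this] have "(v \<bullet> M v) / (norm v)\<^sup>2 \<le> - c"
        unfolding linear_cmul[OF linM] by (simp add: power2_eq_square)
      then show ?thesis using False by (simp add: pos_divide_le_eq)
    qed simp
    \<comment> \<open>With \<open>gf x = gB x / T\<close> the rank-one part of \<open>DG\<close> is
      \<open>(1 - 1 / k) / T\<close> times \<open>(w \<bullet> gB x) gB x\<close>; dividing by
      \<open>f x / k\<close> and using \<open>T = k * \<beta> x / f x\<close> gives
      \<open>a\<close>.\<close>
    define a where "a = (1 - 1 / k) / \<beta> x"
    have DG_eq: "DG k x w = (f x / k) *\<^sub>R (M w + (a * (w \<bullet> gB x)) *\<^sub>R gB x)" for w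
    proof -
      have "f x / k * T = \<beta> x" using fx k2 by (simp add: T_def)
      moreover have "f x / k * (a * (T * (w \<bullet> gf x)) * T) = T * (w \<bullet> gf x) - w \<bullet> gf x / k * T"
        using fx k2 x(1) by (simp add: T_def a_def field_simps)
      ultimately show ?thesis
        unfolding DG_def M_def gB_eq inner_scaleR_right scaleR_add_right scaleR_diff_right scaleR_scaleR
        by (simp add: scaleR_diff_left)
    qed
    \<comment> \<open>The factor 2 absorbs \<open>1 - 1 / k\<close>, which is at least
      \<open>1 / 2\<close> because \<open>k > 2\<close>.\<close>
    have "2 * \<beta> x * E < (norm (gB x))\<^sup>2"
    proof -
      have "2 * \<beta> x * E < d2\<^sup>2"
        using \<beta>_small(4) pos by (simp add: field_simps)
      also have "\<dots> \<le> (norm (gB x))\<^sup>2"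
        using d2(2)[OF xF \<beta>_small(2)] d2(1) by (intro power_mono) auto
      finally show ?thesis .
    qed
    then have "E < 1 / (2 * \<beta> x) * (norm (gB x))\<^sup>2"
      using x(1) by (simp add: field_simps)
    also have "\<dots> \<le> a * (norm (gB x))\<^sup>2"
      using x(1) k2 by (intro mult_right_mono) (auto simp: a_def field_simps)
    finally have aE: "a * (norm (gB x))\<^sup>2 > B + B\<^sup>2 / c"
      by (simp add: E_def)
    have gB0: "gB x \<noteq> 0"
      using d2(2)[OF xF \<beta>_small(2)] d2(1) by auto
    show "(\<forall>w. DG k x w = 0 \<longrightarrow> w = 0) \<and> (\<exists>v. v \<bullet> DG k x v < 0)"
    proof (intro conjI allI impI)
      fix w assume "DG k x w = 0"
      then have ker: "M w + (a * (w \<bullet> gB x)) *\<^sub>R gB x = 0"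
        using fx k2 by (simp add: DG_eq)
      show "w = 0"
        by (rule rank_one_perturbation_kernel[OF linM normM _ gB0 pos(1,3) aE ker]) (rule neg)
    next
      have "2 \<le> DIM(real^'n)"
        using d3(2)[OF xF \<beta>_small(3) gBx] by simp
      then obtain v where v: "v \<noteq> 0" "orthogonal (gB x) v"
        using orthogonal_to_vector_exists by blast
      then have vg: "v \<bullet> gB x = 0" by (simp add: orthogonal_def inner_commute)
      have "v \<bullet> DG k x v = f x / k * (v \<bullet> M v)"
        by (simp add: DG_eq vg)
      also have "\<dots> \<le> f x / k * (- c * (norm v)\<^sup>2)"
        using fx k2 by (intro mult_left_mono[OF neg[OF vg]]) auto
      also have "\<dots> < 0"
        using fx k2 pos(1) v(1) by (intro mult_pos_neg[of "f x / k"]) (auto simp: mult_less_0_iff)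
      finally show "\<exists>v. v \<bullet> DG k x v < 0" by blast
    qed
  qed
qed

text \<open>On the ball \<beta> is bounded below, so critical points solve
  \<open>gf x = (f x / (k \<beta> x)) gB x\<close>: the left side is strongly monotone, and the
  right side has a Lipschitz constant of order \<open>1 / k\<close>. Nondegeneracy is the
  infinitesimal form of the same argument.\<close>

lemma near_critical_points:
  assumes \<rho>: "0 < \<rho>" "cball xs \<rho> \<subseteq> {x. 0 < \<beta> x}"
  shows "\<exists>K. \<forall>k>K. \<forall>x\<in>cball xs \<rho>. G k x = 0 \<longrightarrow>
    (\<forall>w. DG k x w = 0 \<longrightarrow> w = 0) \<and> (\<forall>y\<in>cball xs \<rho>. G k y = 0 \<longrightarrow> y = x)"
proof -
  let ?S = "cball xs \<rho>"
  obtain C where C1: "C \<ge> 1" and C: "\<And>x. x \<in> F \<Longrightarrow> f x \<le> C" "\<And>x. x \<in> F \<Longrightarrow> \<beta> x \<le> C"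
    "\<And>x. x \<in> F \<Longrightarrow> norm (gf x) \<le> C" "\<And>x. x \<in> F \<Longrightarrow> norm (gB x) \<le> C"
    "\<And>x. x \<in> F \<Longrightarrow> norm (Hf x) \<le> C" "\<And>x. x \<in> F \<Longrightarrow> norm (HB x) \<le> C"
    using uniform_bound by blast
  have S\<beta>: "0 < \<beta> x" if "x \<in> ?S" for x using that \<rho>(2) by auto
  have S: "?S \<subseteq> F" using S\<beta> by (force simp: mem_F)
  obtain b where b: "b > 0" "\<And>x. x \<in> ?S \<Longrightarrow> b \<le> \<beta> x"
    using compact_continuous_pos_bound[OF compact_cball[of xs \<rho>], of \<beta>] S\<beta>
      continuous_on_subset[OF has_C2_derivs_on_continuous(1)[OF \<beta>_C2]] by blast
  note f_S = has_C2_derivs_on_subset[OF f_C2 S] and \<beta>_S = has_C2_derivs_on_subset[OF \<beta>_C2_F S]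
  have lip: "\<bar>f y - f x\<bar> \<le> C * norm (y - x)" "\<bar>\<beta> y - \<beta> x\<bar> \<le> C * norm (y - x)"
    "norm (gB y - gB x) \<le> C * norm (y - x)" if "x \<in> ?S" "y \<in> ?S" for x y
  proof -
    show "\<bar>f y - f x\<bar> \<le> C * norm (y - x)"
      by (rule C2_lipschitz(1)[OF f_S convex_cball that]) (use C S in auto)
    show "\<bar>\<beta> y - \<beta> x\<bar> \<le> C * norm (y - x)"
      by (rule C2_lipschitz(1)[OF \<beta>_S convex_cball that]) (use C S in auto)
    show "norm (gB y - gB x) \<le> C * norm (y - x)"
      by (rule C2_lipschitz(2)[OF \<beta>_S convex_cball that]) (use C S in auto)
  qed
  have mono: "l * (norm (y - x))\<^sup>2 \<le> (gf y - gf x) \<bullet> (y - x)" if xy: "x \<in> ?S" "y \<in> ?S" for x y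
  proof -
    obtain t where t: "t \<in> {0<..<1}"
      and eq: "(gf y - gf x) \<bullet> (y - x) = (Hf (x + t *\<^sub>R (y - x)) *v (y - x)) \<bullet> (y - x)"
      using gradient_mvt[OF convex_cball xy has_C2_derivs_onD(2)[OF f_S]] by blast
    have "x + t *\<^sub>R (y - x) \<in> ?S"
      using convexD_alt[OF convex_cball xy, of t] t by (simp add: algebra_simps)
    from Hf_lower[OF S\<beta>[OF this], of "y - x"] show ?thesis
      unfolding eq by (simp only: inner_commute)
  qed
  show ?thesis
  proof (rule exI[of _ "max 2 (max (C\<^sup>2 / (b * l)) (3 * C ^ 3 / (b\<^sup>2 * l)))"], intro allI impI ballI conjI)
    fix k x w
    assume k: "max 2 (max (C\<^sup>2 / (b * l)) (3 * C ^ 3 / (b\<^sup>2 * l))) < k"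
      and x: "x \<in> ?S" and crit: "G k x = 0" and w: "DG k x w = 0"
    have k2: "k > 2" and kb: "C\<^sup>2 < k * (b * l)"
      using k b(1) l_pos by (auto simp: field_simps)
    have xF: "x \<in> F" using S x by blast
    \<comment> \<open>After scaling by \<open>k\<close> the Hessian of \<open>f\<close> carries the
      factor \<open>k\<close> and that of \<beta> does not. The rank-one terms have a favourable
      sign because \<open>gf x\<close> is a nonnegative multiple of \<open>gB x\<close>.\<close>
    have "0 = k * (w \<bullet> DG k x w)" by (simp add: w)
    also have "\<dots> = k * ((w \<bullet> gB x) * (w \<bullet> gf x) * (1 - 1 / k)) + k * (\<beta> x * (w \<bullet> (Hf x *v w)))
        - f x * (w \<bullet> (HB x *v w))"
      using k2 by (simp add: DG_def inner_diff_right inner_add_right field_simps)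
    finally have eq: "k * ((w \<bullet> gB x) * (w \<bullet> gf x) * (1 - 1 / k)) + k * (\<beta> x * (w \<bullet> (Hf x *v w)))
        = f x * (w \<bullet> (HB x *v w))" by simp
    have "\<beta> x *\<^sub>R gf x = (f x / k) *\<^sub>R gB x" using crit by (simp add: G_def)
    then have wgf: "\<beta> x * (w \<bullet> gf x) = f x / k * (w \<bullet> gB x)"
      by (metis inner_scaleR_right)
    have "\<beta> x * ((w \<bullet> gB x) * (w \<bullet> gf x)) = (w \<bullet> gB x) * (\<beta> x * (w \<bullet> gf x))"
      by simp
    also have "\<dots> = f x / k * (w \<bullet> gB x)\<^sup>2"
      unfolding wgf by (simp add: power2_eq_square)
    also have "\<dots> \<ge> 0" using f_nonneg[OF xF] k2 by simp
    finally have "(w \<bullet> gB x) * (w \<bullet> gf x) \<ge> 0"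
      using S\<beta>[OF x] by (simp add: zero_le_mult_iff)
    then have 1: "0 \<le> k * ((w \<bullet> gB x) * (w \<bullet> gf x) * (1 - 1 / k))"
      using k2 by (intro mult_nonneg_nonneg[of k] mult_nonneg_nonneg[of "_ * _"]) auto
    have "k * (b * (l * (norm w)\<^sup>2)) \<le> k * (\<beta> x * (w \<bullet> (Hf x *v w)))"
      using k2 b l_pos x Hf_lower[OF S\<beta>[OF x], of w] S\<beta>[OF x]
      by (intro mult_left_mono mult_mono) auto
    also have "\<dots> \<le> f x * (w \<bullet> (HB x *v w))" using 1 eq by linarith
    also have "\<dots> \<le> C * (C * (norm w)\<^sup>2)"
    proof -
      have "w \<bullet> (HB x *v w) \<le> norm w * (norm (HB x) * norm w)"
        by (rule order_trans[OF norm_cauchy_schwarz mult_left_mono[OF norm_matrix_vector_mult_le]]) simp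
      also have "\<dots> \<le> norm w * (C * norm w)"
        using C(6)[OF xF] by (intro mult_left_mono mult_right_mono) auto
      finally have "f x * (w \<bullet> (HB x *v w)) \<le> f x * (C * (norm w)\<^sup>2)"
        using f_nonneg[OF xF] by (intro mult_left_mono) (auto simp: power2_eq_square mult_ac)
      also have "\<dots> \<le> C * (C * (norm w)\<^sup>2)"
        using C(1)[OF xF] C1 by (intro mult_right_mono) auto
      finally show ?thesis .
    qed
    finally have "(k * (b * l) - C\<^sup>2) * (norm w)\<^sup>2 \<le> 0"
      by (simp add: algebra_simps power2_eq_square)
    then show "w = 0" using kb by (simp add: mult_le_0_iff)
  next
    fix k x y
    assume k: "max 2 (max (C\<^sup>2 / (b * l)) (3 * C ^ 3 / (b\<^sup>2 * l))) < k"
      and x: "x \<in> ?S" and y: "y \<in> ?S" and crit: "G k x = 0" "G k y = 0"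
    have k2: "k > 2" and kb: "3 * C ^ 3 < k * (b\<^sup>2 * l)"
      using k b(1) l_pos by (auto simp: field_simps)
    have F: "x \<in> F" "y \<in> F" using S x y by auto
    let ?d = "y - x"
    have cr: "(k * \<beta> z) *\<^sub>R gf z = f z *\<^sub>R gB z" if "G k z = 0" for z
    proof -
      have "\<beta> z *\<^sub>R gf z = (f z / k) *\<^sub>R gB z" using that by (simp add: G_def)
      then have "k *\<^sub>R (\<beta> z *\<^sub>R gf z) = k *\<^sub>R ((f z / k) *\<^sub>R gB z)" by simp
      then show ?thesis using k2 by simp
    qed
    \<comment> \<open>The two critical equations are cross-multiplied so that no quotient by \<beta>
      has to be estimated; the right side then telescopes into differences of \<open>gB\<close>,
      \<open>f\<close> and \<beta>.\<close>
    have "(k * (\<beta> x * \<beta> y)) *\<^sub>R (gf y - gf x)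
        = \<beta> x *\<^sub>R ((k * \<beta> y) *\<^sub>R gf y) - \<beta> y *\<^sub>R ((k * \<beta> x) *\<^sub>R gf x)"
      by (simp add: algebra_simps)
    also have "\<dots> = (\<beta> x * f y) *\<^sub>R (gB y - gB x) + (\<beta> x * (f y - f x) + f x * (\<beta> x - \<beta> y)) *\<^sub>R gB x"
      unfolding cr[OF crit(1)] cr[OF crit(2)] by (simp add: algebra_simps)
    finally have eq: "(k * (\<beta> x * \<beta> y)) *\<^sub>R (gf y - gf x) =
        (\<beta> x * f y) *\<^sub>R (gB y - gB x) + (\<beta> x * (f y - f x) + f x * (\<beta> x - \<beta> y)) *\<^sub>R gB x" .
    have nn: "0 \<le> \<beta> x" "0 \<le> f x" "0 \<le> f y" "0 \<le> C" using F f_nonneg C1 by (auto simp: mem_F)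
    have "norm ((k * (\<beta> x * \<beta> y)) *\<^sub>R (gf y - gf x)) \<le> norm ((\<beta> x * f y) *\<^sub>R (gB y - gB x))
        + norm ((\<beta> x * (f y - f x) + f x * (\<beta> x - \<beta> y)) *\<^sub>R gB x)"
      unfolding eq by (rule norm_triangle_ineq)
    also have "\<dots> \<le> (C * C) * (C * norm ?d) + (C * (C * norm ?d) + C * (C * norm ?d)) * C"
    proof (rule add_mono)
      have "norm ((\<beta> x * f y) *\<^sub>R (gB y - gB x)) = (\<beta> x * f y) * norm (gB y - gB x)"
        using nn by simp
      also have "\<dots> \<le> (C * C) * (C * norm ?d)"
        using C(1)[OF F(2)] C(2)[OF F(1)] lip(3)[OF x y] nn by (intro mult_mono) auto
      finally show "norm ((\<beta> x * f y) *\<^sub>R (gB y - gB x)) \<le> (C * C) * (C * norm ?d)" .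
      have "\<bar>\<beta> x * (f y - f x) + f x * (\<beta> x - \<beta> y)\<bar> \<le> \<beta> x * \<bar>f y - f x\<bar> + f x * \<bar>\<beta> y - \<beta> x\<bar>"
        using abs_triangle_ineq[of "\<beta> x * (f y - f x)" "f x * (\<beta> x - \<beta> y)"] nn
        by (simp add: abs_mult abs_minus_commute)
      also have "\<dots> \<le> C * (C * norm ?d) + C * (C * norm ?d)"
        using C(1)[OF F(1)] C(2)[OF F(1)] lip(1,2)[OF x y] nn by (intro add_mono mult_mono) auto
      finally have "\<bar>\<beta> x * (f y - f x) + f x * (\<beta> x - \<beta> y)\<bar> \<le> C * (C * norm ?d) + C * (C * norm ?d)" .
      then show "norm ((\<beta> x * (f y - f x) + f x * (\<beta> x - \<beta> y)) *\<^sub>R gB x)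
          \<le> (C * (C * norm ?d) + C * (C * norm ?d)) * C"
        unfolding norm_scaleR using C(4)[OF F(1)] by (intro mult_mono) auto
    qed
    \<comment> \<open>Each of the three differences contributes \<open>C ^ 3\<close>; this is the 3
      in the bound on \<open>k\<close>.\<close>
    also have "\<dots> = 3 * C ^ 3 * norm ?d"
      by (simp add: power3_eq_cube algebra_simps)
    finally have up: "norm ((k * (\<beta> x * \<beta> y)) *\<^sub>R (gf y - gf x)) \<le> 3 * C ^ 3 * norm ?d" .
    have "k * (b * b) * (l * (norm ?d)\<^sup>2) \<le> k * (\<beta> x * \<beta> y) * ((gf y - gf x) \<bullet> ?d)"
      using b(1) b(2)[OF x] b(2)[OF y] k2 l_pos by (intro mult_mono mono x y) auto
    also have "\<dots> = ((k * (\<beta> x * \<beta> y)) *\<^sub>R (gf y - gf x)) \<bullet> ?d" by simp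
    also have "\<dots> \<le> 3 * C ^ 3 * norm ?d * norm ?d"
      by (rule order_trans[OF norm_cauchy_schwarz mult_right_mono[OF up]]) simp
    finally have "(k * (b\<^sup>2 * l) - 3 * C ^ 3) * (norm ?d)\<^sup>2 \<le> 0"
      by (simp add: algebra_simps power2_eq_square)
    then show "y = x" using kb by (simp add: mult_le_0_iff)
  qed
qed

lemma local_min_on_\<phi>:
  assumes "k > 2" and min: "local_min_on F (\<phi> k) x"
  shows "0 < \<beta> x" "G k x = 0" "0 \<le> v \<bullet> DG k x v"
proof -
  have xF: "x \<in> F" using min by (simp add: local_min_on_def)
  obtain e where e: "e > 0" "\<And>y. y \<in> F \<inter> ball x e \<Longrightarrow> \<phi> k x \<le> \<phi> k y"
    using min by (auto simp: local_min_on_def)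
  show \<beta>x: "0 < \<beta> x"
  proof (rule ccontr)
    assume "\<not> 0 < \<beta> x"
    then have 0: "\<beta> x = 0" using xF by (simp add: mem_F)
    obtain y where y: "y \<in> ball x e" "\<beta> x < \<beta> y"
      using gradient_nonzero_increase_decrease(1)[OF \<beta>_has_derivative gB_nonzero[OF 0] e(1)] by blast
    have yF: "y \<in> F" using y(2) 0 by (simp add: mem_F)
    have "\<phi> k x \<le> \<phi> k y" using e(2) y(1) yF by blast
    moreover have "\<phi> k x = 1" "\<phi> k y \<noteq> 1" "\<phi> k y \<le> 1"
      using \<phi>_eq_1_iff[OF xF, of k] \<phi>_eq_1_iff[OF yF, of k] \<phi>_le_1[OF yF, of k] 0 y(2) assms(1)
      by auto
    ultimately show False by simp
  qed
  have xi: "x \<in> interior F" using \<beta>x by (simp add: interior_F)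
  obtain H where H: "has_C2_derivs_on (\<phi> k) (\<lambda>x. \<sigma> k x *\<^sub>R G k x) H F"
    using \<phi>_C2[OF assms(1)] by blast
  show G0: "G k x = 0"
    using local_min_on_interior(1)[OF H xi min] \<sigma>_pos[OF xF, of k] by simp
  have "0 \<le> v \<bullet> (H x *v v)" by (rule local_min_on_interior(2)[OF H xi min])
  then show "0 \<le> v \<bullet> DG k x v"
    unfolding \<phi>_hessian_at_critical[OF assms(1) H \<beta>x G0]
    using \<sigma>_pos[OF xF, of k] by (simp add: zero_le_mult_iff)
qed

theorem navigation_function_\<phi>:
  assumes "\<epsilon> > 0"
  shows "\<exists>K. \<forall>k>K. \<exists>p. navigation_function F (\<phi> k) p \<and> norm (p - xs) < \<epsilon> \<and>
    (f xs = 0 \<or> gB xs = 0 \<longrightarrow> p = xs)"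
proof -
  have "xs \<in> interior F" using \<beta>_xs by (simp add: interior_F)
  then obtain e where e: "e > 0" "ball xs e \<subseteq> {x. 0 < \<beta> x}"
    by (metis interior_F interior_interior mem_interior)
  \<comment> \<open>Being below \<epsilon> yields the distance claim; being below \<open>e\<close>
    keeps the closed ball inside the open set where \<beta> is positive.\<close>
  define \<rho> where "\<rho> = min e \<epsilon> / 2"
  have \<rho>: "\<rho> > 0" "\<rho> < \<epsilon>" "\<rho> < e" using e(1) assms by (auto simp: \<rho>_def)
  then have \<rho>_cball: "cball xs \<rho> \<subseteq> {x. 0 < \<beta> x}" by (intro order_trans[OF _ e(2)]) auto
  obtain K1 where K1: "\<And>k x w. K1 < k \<Longrightarrow> 0 < \<beta> x \<Longrightarrow> \<rho> \<le> norm (x - xs) \<Longrightarrow> G k x = 0 \<Longrightarrow>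
      DG k x w = 0 \<Longrightarrow> w = 0"
    "\<And>k x. K1 < k \<Longrightarrow> 0 < \<beta> x \<Longrightarrow> \<rho> \<le> norm (x - xs) \<Longrightarrow> G k x = 0 \<Longrightarrow> \<exists>v. v \<bullet> DG k x v < 0"
    using far_critical_points[OF \<rho>(1)] by blast
  obtain K2 where K2: "\<And>k x w. K2 < k \<Longrightarrow> x \<in> cball xs \<rho> \<Longrightarrow> G k x = 0 \<Longrightarrow> DG k x w = 0 \<Longrightarrow> w = 0"
    "\<And>k x y. K2 < k \<Longrightarrow> x \<in> cball xs \<rho> \<Longrightarrow> G k x = 0 \<Longrightarrow> y \<in> cball xs \<rho> \<Longrightarrow> G k y = 0 \<Longrightarrow> y = x"
    using near_critical_points[OF \<rho>(1) \<rho>_cball] by blast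
  show ?thesis
  proof (rule exI[of _ "max 2 (max K1 K2)"], intro allI impI)
    fix k assume "max 2 (max K1 K2) < k"
    then have k: "k > 2" "k > K1" "k > K2" by auto
    obtain H where H: "has_C2_derivs_on (\<phi> k) (\<lambda>x. \<sigma> k x *\<^sub>R G k x) H F"
      using \<phi>_C2[OF k(1)] by blast
    have "F \<noteq> {}" using \<beta>_xs mem_F[of xs] by auto
    then obtain p where p: "p \<in> F" "\<And>y. y \<in> F \<Longrightarrow> \<phi> k p \<le> \<phi> k y"
      using continuous_attains_inf[OF F_compact _ has_C2_derivs_on_continuous(1)[OF H]] by blast
    then have p_min: "local_min_on F (\<phi> k) p"
      by (auto simp: local_min_on_def intro: exI[of _ 1])
    have in_cball: "x \<in> cball xs \<rho>" if "local_min_on F (\<phi> k) x" for x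
    proof (rule ccontr)
      assume "x \<notin> cball xs \<rho>"
      then have "\<rho> \<le> norm (x - xs)" by (simp add: dist_norm norm_minus_commute)
      with K1(2)[OF k(2)] local_min_on_\<phi>[OF k(1) that] show False
        using not_less by blast
    qed
    have unique: "{x. local_min_on F (\<phi> k) x} = {p}"
      using p_min in_cball K2(2)[OF k(3)] local_min_on_\<phi>(2)[OF k(1)] by blast
    have nondeg: "det (H x) \<noteq> 0" if x: "x \<in> F" and "\<sigma> k x *\<^sub>R G k x = 0" for x
    proof -
      have G0: "G k x = 0" using that \<sigma>_pos[OF x, of k] by simp
      \<comment> \<open>On the boundary \<open>G k x\<close> is \<open>- (f x / k) gB x\<close>,
        which is nonzero, so the Morse condition has content only at interior points.\<close>
      have \<beta>x: "0 < \<beta> x"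
      proof (rule ccontr)
        assume "\<not> 0 < \<beta> x"
        then have 0: "\<beta> x = 0" using x by (simp add: mem_F)
        then have "0 < f x" using f_pos[OF x] \<beta>_xs by (cases "x = xs") auto
        then show False using G0 0 gB_nonzero[OF 0] k(1) by (simp add: G_def)
      qed
      have ker: "w = 0" if "H x *v w = 0" for w
      proof -
        have DG0: "DG k x w = 0"
          using that \<sigma>_pos[OF x, of k] by (simp add: \<phi>_hessian_at_critical[OF k(1) H \<beta>x G0])
        show ?thesis
        proof (cases "x \<in> cball xs \<rho>")
          case True
          then show ?thesis using K2(1)[OF k(3) _ G0 DG0] by blast
        next
          case False
          then have "\<rho> \<le> norm (x - xs)" by (simp add: dist_norm norm_minus_commute)
          then show ?thesis using K1(1)[OF k(2) \<beta>x _ G0 DG0] by blast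
        qed
      qed
      then have "invertible (H x)"
        by (metis invertible_left_inverse matrix_left_invertible_ker)
      then show ?thesis by (simp add: invertible_det_nz)
    qed
    have "navigation_function F (\<phi> k) p"
      unfolding navigation_function_def C2_Morse_on_def C2_on_def
    proof (intro conjI)
      show "\<phi> k \<in> F \<rightarrow> {0..1}" using \<phi>_nonneg \<phi>_le_1 k(1) by auto
      show "p \<in> interior F" using local_min_on_\<phi>(1)[OF k(1) p_min] by (simp add: interior_F)
      show "\<exists>g H. has_C2_derivs_on (\<phi> k) g H F" using H by blast
      show "{x. local_min_on F (\<phi> k) x} = {p}" by (rule unique)
      show "\<exists>g H. has_C2_derivs_on (\<phi> k) g H F \<and> (\<forall>x\<in>F. g x = 0 \<longrightarrow> det (H x) \<noteq> 0)"
        using H nondeg by blast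
      show "frontier F = {x \<in> F. \<phi> k x = 1}"
        using \<phi>_eq_1_iff[of _ k] k(1) by (auto simp: frontier_F mem_F)
    qed
    moreover have "norm (p - xs) < \<epsilon>"
      using in_cball[OF p_min] \<rho>(2) by (simp add: dist_norm norm_minus_commute)
    \<comment> \<open>Either condition makes \<open>xs\<close> itself critical, since
      \<open>gf xs = 0\<close>; uniqueness inside the ball then identifies it with
      \<open>p\<close>.\<close>
    moreover have "p = xs" if "f xs = 0 \<or> gB xs = 0"
    proof (rule K2(2)[OF k(3)])
      show "G k xs = 0" using that by (auto simp: G_def gf_xs)
      show "xs \<in> cball xs \<rho>" using \<rho>(1) by simp
      show "p \<in> cball xs \<rho>" "G k p = 0" by (rule in_cball[OF p_min], rule local_min_on_\<phi>(2)[OF k(1) p_min])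
    qed
    ultimately show "\<exists>p. navigation_function F (\<phi> k) p \<and> norm (p - xs) < \<epsilon> \<and>
        (f xs = 0 \<or> gB xs = 0 \<longrightarrow> p = xs)"
      by blast
  qed
qed

end

subsection \<open>Obstacle data\<close>

lemma has_C2_derivs_on_quadratic:
  fixes A :: "real^'n^'n"
  assumes "transpose A = A"
  shows "has_C2_derivs_on (\<lambda>x. (x - c) \<bullet> (A *v (x - c)) - a) (\<lambda>x. 2 *\<^sub>R (A *v (x - c)))
    (\<lambda>x. 2 *\<^sub>R A) S"
  unfolding has_C2_derivs_on_def
proof (intro conjI ballI)
  fix x assume "x \<in> S"
  have A': "((\<lambda>x. A *v (x - c)) has_derivative (\<lambda>h. A *v h)) (at x within S)"
    by (rule has_derivative_eq_rhs, rule bounded_linear.has_derivative[OF matrix_vector_mul_bounded_linear],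
        rule derivative_intros, rule derivative_intros, rule derivative_intros) simp
  have c': "((\<lambda>x. x - c) has_derivative (\<lambda>h. h)) (at x within S)"
    by (rule has_derivative_eq_rhs, rule derivative_intros, rule derivative_intros, rule derivative_intros) simp
  show "((\<lambda>x. (x - c) \<bullet> (A *v (x - c)) - a) has_derivative (\<lambda>h. h \<bullet> 2 *\<^sub>R (A *v (x - c)))) (at x within S)"
    by (rule has_derivative_eq_rhs[OF has_derivative_diff[OF has_derivative_inner[OF c' A'] has_derivative_const]])
      (simp add: fun_eq_iff symmetric_inner_matrix[OF assms, of "x - c"])
  show "((\<lambda>x. 2 *\<^sub>R (A *v (x - c))) has_derivative (*v) (2 *\<^sub>R A)) (at x within S)"
    by (rule has_derivative_eq_rhs[OF has_derivative_scaleR_right[OF A']])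
      (simp add: fun_eq_iff scaleR_matrix_vector_mult)
qed simp

lemma has_C2_derivs_on_prod:
  assumes "finite I" "\<And>i. i \<in> I \<Longrightarrow> \<exists>g H. has_C2_derivs_on (b i) g H S"
  shows "\<exists>g H. has_C2_derivs_on (\<lambda>x. \<Prod>i\<in>I. b i x) g H S"
  using assms
proof (induction I rule: finite_induct)
  case empty
  have "has_C2_derivs_on (\<lambda>x. 1) (\<lambda>x. 0) (\<lambda>x. 0) S" by (rule has_C2_derivs_on_const)
  then show ?case unfolding prod.empty by blast
next
  case (insert i I)
  obtain g H where "has_C2_derivs_on (b i) g H S" using insert.prems[of i] by blast
  moreover obtain g' H' where "has_C2_derivs_on (\<lambda>x. \<Prod>i\<in>I. b i x) g' H' S"
    using insert.IH insert.prems by blast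
  ultimately have "has_C2_derivs_on (\<lambda>x. b i x * (\<Prod>i\<in>I. b i x)) (\<lambda>x. b i x *\<^sub>R g' x + (\<Prod>i\<in>I. b i x) *\<^sub>R g x)
    (\<lambda>x. b i x *\<^sub>R H' x + (\<Prod>i\<in>I. b i x) *\<^sub>R H x + outer (g' x) (g x) + outer (g x) (g' x)) S"
    by (rule has_C2_derivs_on_mult)
  then show ?case unfolding prod.insert[OF insert.hyps] by blast
qed

text \<open>Write the product as \<open>b i\<close> times the rest. Where \<open>b i\<close>
  vanishes, the derivatives of the rest survive only in the cross terms of the Hessian, and these
  vanish on vectors orthogonal to \<open>g x\<close>.\<close>

lemma total_beta_derivs_at_zero:
  assumes tb: "has_C2_derivs_on (total_beta m b) gB HB UNIV"
    and C2: "\<And>j. j \<in> {0..m} \<Longrightarrow> \<exists>g H. has_C2_derivs_on (b j) g H UNIV"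
    and i: "i \<in> {0..m}" and bi: "has_C2_derivs_on (b i) g H UNIV" and zero: "b i x = 0"
  shows "gB x = (\<Prod>j\<in>{0..m}-{i}. b j x) *\<^sub>R g x"
    and "v \<bullet> g x = 0 \<Longrightarrow> v \<bullet> (HB x *v v) = (\<Prod>j\<in>{0..m}-{i}. b j x) * (v \<bullet> (H x *v v))"
proof -
  obtain g' H' where rest: "has_C2_derivs_on (\<lambda>x. \<Prod>j\<in>{0..m}-{i}. b j x) g' H' UNIV"
    using has_C2_derivs_on_prod[of "{0..m} - {i}" b UNIV] C2 by auto
  have eq: "total_beta m b = (\<lambda>x. b i x * (\<Prod>j\<in>{0..m}-{i}. b j x))"
    unfolding total_beta_def fun_eq_iff using i by (intro allI prod.remove) auto
  note u = has_C2_derivs_on_unique[OF tb[unfolded eq] has_C2_derivs_on_mult[OF bi rest]]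
  show "gB x = (\<Prod>j\<in>{0..m}-{i}. b j x) *\<^sub>R g x"
    by (simp add: u(1) zero)
  show "v \<bullet> (HB x *v v) = (\<Prod>j\<in>{0..m}-{i}. b j x) * (v \<bullet> (H x *v v))" if "v \<bullet> g x = 0"
    using that by (simp add: u(2) zero matrix_vector_mult_add_rdistrib scaleR_matrix_vector_mult
        outer_mult_vec inner_add_right)
qed

lemma concave_gradient_ineq:
  fixes f :: "'a::real_inner \<Rightarrow> real"
  assumes conc: "concave_on UNIV f" and f: "(f has_derivative (\<lambda>h. h \<bullet> g)) (at x)"
  shows "f y - f x \<le> (y - x) \<bullet> g"
proof (rule ccontr)
  assume "\<not> ?thesis"
  then have neg: "(y - x) \<bullet> g - (f y - f x) < 0" by simp
  \<comment> \<open>Concavity puts the graph above the chord, so \<open>?h t\<close> is at least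
    \<open>?h 0\<close> on the unit interval; a negative slope at 0 contradicts this.\<close>
  let ?h = "\<lambda>t. f (x + t *\<^sub>R (y - x)) - t * (f y - f x)"
  have "((\<lambda>t. x + t *\<^sub>R (y - x)) has_derivative (\<lambda>t. t *\<^sub>R (y - x))) (at 0)"
    by (auto intro!: derivative_eq_intros)
  then have "((\<lambda>t. f (x + t *\<^sub>R (y - x))) has_derivative (\<lambda>t. t *\<^sub>R (y - x) \<bullet> g)) (at 0)"
    by (rule has_derivative_compose) (simp add: f)
  then have "((\<lambda>t. f (x + t *\<^sub>R (y - x))) has_real_derivative (y - x) \<bullet> g) (at 0)"
    by (rule has_derivative_imp_has_field_derivative) simp
  moreover have "((\<lambda>t. t * (f y - f x)) has_real_derivative f y - f x) (at 0)"
    by (auto intro!: derivative_eq_intros)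
  ultimately have "(?h has_real_derivative (y - x) \<bullet> g - (f y - f x)) (at 0)"
    by (rule DERIV_diff)
  from DERIV_neg_dec_right[OF this neg] obtain d where d: "d > 0" "\<And>h. 0 < h \<Longrightarrow> h < d \<Longrightarrow> ?h h < ?h 0"
    by auto
  define t where "t = min (d / 2) 1"
  have t: "0 < t" "t < d" "t \<le> 1" using d(1) by (auto simp: t_def)
  have "(1 - t) * f x + t * f y \<le> f ((1 - t) *\<^sub>R x + t *\<^sub>R y)"
    using conc t by (auto simp: concave_on_iff)
  moreover have "(1 - t) *\<^sub>R x + t *\<^sub>R y = x + t *\<^sub>R (y - x)" by (simp add: algebra_simps)
  ultimately show False using d(2)[OF t(1,2)] by (simp add: algebra_simps)
qed

lemma total_beta_zeroE:
  assumes disjoint: "obstacles_disjoint m b" and zero: "total_beta m b x = 0"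
  obtains i where "i \<in> {0..m}" "b i x = 0" "0 < (\<Prod>j\<in>{0..m}-{i}. b j x)"
proof -
  obtain i where i: "i \<in> {0..m}" "b i x = 0"
    using zero by (auto simp: total_beta_def)
  moreover have "0 < (\<Prod>j\<in>{0..m}-{i}. b j x)"
    using disjoint i by (intro prod_pos) (auto simp: obstacles_disjoint_def dest!: spec[of _ x])
  ultimately show ?thesis using that by blast
qed

text \<open>On a line the obstacle is an interval around \<open>c\<close> of half-length
  \<open>s\<close>. Its endpoints are zeros of \<open>b i\<close> and hence free, so a connected
  free space would contain the centre, where \<open>b i\<close> is negative.\<close>

lemma obstacle_disconnects_line:
  fixes b :: "nat \<Rightarrow> real^'n \<Rightarrow> real"
  assumes dim: "CARD('n) = 1" and disjoint: "obstacles_disjoint m b"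
    and conn: "connected (free_space m b)" and i: "i \<in> {1..m}"
    and bi: "\<And>x. b i x = (x - c) \<bullet> (A *v (x - c)) - a" and "0 < a" and A: "pos_def A"
  shows False
proof -
  obtain j :: 'n where j: "UNIV = {j}" using dim card_1_singletonE by blast
  define e :: "real^'n" where "e = axis j 1"
  have e: "e \<noteq> 0" by (simp add: e_def axis_eq_0_iff)
  define s where "s = sqrt (a / (e \<bullet> (A *v e)))"
  have eAe: "e \<bullet> (A *v e) > 0" using A e by (simp add: pos_def_def)
  have s: "s > 0" "s\<^sup>2 * (e \<bullet> (A *v e)) = a" using \<open>0 < a\<close> eAe by (auto simp: s_def)
  have on: "c + t *\<^sub>R e \<in> free_space m b" if "t\<^sup>2 = s\<^sup>2" for t
  proof -
    have "b i (c + t *\<^sub>R e) = t\<^sup>2 * (e \<bullet> (A *v e)) - a"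
      by (simp add: bi matrix_vector_mult_scaleR power2_eq_square)
    then have "b i (c + t *\<^sub>R e) = 0" using s(2) that by simp
    then have "total_beta m b (c + t *\<^sub>R e) = 0"
      using i by (auto simp: total_beta_def)
    then show ?thesis by (simp add: free_space_def)
  qed
  have "\<exists>z \<in> free_space m b. z $ j = c $ j"
    using on[of s] on[of "- s"] s(1)
    by (intro connected_ivt_component_cart[OF conn, of "c + (- s) *\<^sub>R e" "c + s *\<^sub>R e"]) (auto simp: e_def)
  then obtain z where z: "z \<in> free_space m b" "z $ j = c $ j" by blast
  have "z = c"
    using z(2) j by (auto simp: vec_eq_iff)
  moreover have "b i c < 0" using \<open>0 < a\<close> by (simp add: bi)
  ultimately show False
    using z(1) i by (auto simp: free_space_eq[OF disjoint] obstacle_def)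
qed

section \<open>The abstract hypotheses verified for ellipsoidal obstacles\<close>

theorem theorem3:
  fixes X :: "(real^'n) set"
    and b :: "nat \<Rightarrow> real^'n \<Rightarrow> real"
    and m :: nat
    and f0 :: "real^'n \<Rightarrow> real"
    and grad_f0 :: "real^'n \<Rightarrow> real^'n"
    and hess_f0 :: "real^'n \<Rightarrow> real^'n^'n"
    and lmin lmax :: real
    and xstar :: "real^'n"
    and A :: "nat \<Rightarrow> real^'n^'n"
    and c :: "nat \<Rightarrow> real^'n"
    and r :: "nat \<Rightarrow> real"
  assumes X: "X \<noteq> {}" "compact X" "convex X"
    and b0: "C2_on (b 0) UNIV" "concave_on UNIV (b 0)"
    and X_b0: "X = {x. b 0 x \<ge> 0}" "frontier X = {x. b 0 x = 0}"
    and A: "\<forall>i\<in>{1..m}. transpose (A i) = A i \<and> pos_def (A i)"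
    and r: "\<forall>i\<in>{1..m}. r i > 0"
    and bi: "\<forall>i\<in>{1..m}. \<forall>x.
               b i x = (x - c i) \<bullet> (A i *v (x - c i)) - min_eigenvalue (A i) * (r i)\<^sup>2"
    and obstacles_in_X: "\<forall>i\<in>{1..m}. obstacle b i \<subseteq> X"
    and disjoint: "obstacles_disjoint m b"
    and F_manifold: "compact (free_space m b)" "connected (free_space m b)"
                    "analytic_manifold_with_boundary (free_space m b)"
    and f0_nonneg: "\<forall>x\<in>X. f0 x \<ge> 0"
    and f0_C2: "has_C2_derivs_on f0 grad_f0 hess_f0 X"
    and f0_convex: "strongly_convex_on X f0"
    and f0_eigenvalues: "\<forall>x\<in>X. eigenvalues (hess_f0 x) \<subseteq> {lmin..lmax}"
    and lmin_pos: "lmin > 0"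
    and xstar: "is_arg_min f0 (\<lambda>x. x \<in> X) xstar" "xstar \<in> interior (free_space m b)"
    and cond: "\<forall>i\<in>{1..m}. lmax / lmin * (max_eigenvalue (A i) / min_eigenvalue (A i))
                 < 1 + norm (c i - xstar) / r i"
  shows "\<forall>\<epsilon>>0. \<exists>K. \<forall>k>K. \<exists>xbar.
           navigation_function (free_space m b) (potential f0 m b k) xbar \<and>
           norm (xbar - xstar) < \<epsilon> \<and>
           (f0 xstar = 0 \<or> GDERIV (total_beta m b) xstar :> 0 \<longrightarrow> xbar = xstar)"
proof -
  define F where "F = free_space m b"
  define tb where "tb = total_beta m b"
  have F_eq: "F = {x. 0 \<le> tb x}" by (simp add: F_def free_space_def tb_def)
  have F_X: "F \<subseteq> X" unfolding F_def free_space_eq[OF disjoint] X_b0(1) by blast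
  have int_X: "x \<in> interior X" if "b 0 x > 0" for x
  proof -
    have "x \<in> X" "x \<notin> frontier X" using that X_b0 by auto
    then show ?thesis using closure_subset[of X] by (auto simp: frontier_def)
  qed
  have b_F: "0 \<le> b j x" if "x \<in> F" "j \<in> {0..m}" for x j
    using that unfolding F_def free_space_eq[OF disjoint]
    by (cases "j = 0") (auto simp: obstacle_def not_less)
  have b_pos: "0 < b j x" if "0 < tb x" "j \<in> {0..m}" for x j
  proof -
    have "b j x \<noteq> 0"
    proof
      assume "b j x = 0"
      then have "tb x = 0"
        unfolding tb_def total_beta_def using that(2) by (intro prod_zero) auto
      then show False using that(1) by simp
    qed
    moreover have "0 \<le> b j x" using that by (intro b_F) (simp_all add: F_eq)
    ultimately show ?thesis by simp
  qed
  have xs_F: "xstar \<in> F" using xstar(2) interior_subset by (auto simp: F_def)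
  have xs_int: "xstar \<in> interior X"
    using xstar(2) interior_mono[OF F_X] by (auto simp: F_def)
  have b0_xs: "0 < b 0 xstar"
    using X_b0 xs_int interior_subset[of X] by (fastforce simp: frontier_def)

  obtain g0 H0 where b0_C2: "has_C2_derivs_on (b 0) g0 H0 UNIV"
    using b0(1) by (auto simp: C2_on_def)
  have bi_C2: "has_C2_derivs_on (b i) (\<lambda>x. 2 *\<^sub>R (A i *v (x - c i))) (\<lambda>x. 2 *\<^sub>R A i) UNIV"
    if "i \<in> {1..m}" for i
  proof -
    have eq: "b i = (\<lambda>x. (x - c i) \<bullet> (A i *v (x - c i)) - min_eigenvalue (A i) * (r i)\<^sup>2)"
      using bi that by blast
    show ?thesis
      unfolding eq by (rule has_C2_derivs_on_quadratic) (use A that in blast)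
  qed
  have b_C2: "\<exists>g H. has_C2_derivs_on (b j) g H UNIV" if "j \<in> {0..m}" for j
  proof (cases "j = 0")
    case True
    show ?thesis unfolding True by (intro exI) (rule b0_C2)
  next
    case False
    then show ?thesis using that by (intro exI) (rule bi_C2, simp)
  qed
  have "\<exists>g H. has_C2_derivs_on (\<lambda>x. \<Prod>i\<in>{0..m}. b i x) g H UNIV"
    by (rule has_C2_derivs_on_prod) (simp, rule b_C2)
  then obtain gB HB where tb_C2: "has_C2_derivs_on tb gB HB UNIV"
    unfolding tb_def total_beta_def[abs_def] by blast
  have derivs_at_zero: "gB x = (\<Prod>j\<in>{0..m}-{i}. b j x) *\<^sub>R g x"
    "v \<bullet> g x = 0 \<Longrightarrow> v \<bullet> (HB x *v v) = (\<Prod>j\<in>{0..m}-{i}. b j x) * (v \<bullet> (H x *v v))"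
    if i: "i \<in> {0..m}" "has_C2_derivs_on (b i) g H UNIV" "b i x = 0" for i g H x v
    by (rule total_beta_derivs_at_zero(1)[OF tb_C2[unfolded tb_def] _ i], rule b_C2, assumption,
        rule total_beta_derivs_at_zero(2)[OF tb_C2[unfolded tb_def] _ i], rule b_C2)

  have A_sym: "transpose (A i) = A i" and A_pd: "pos_def (A i)" and r_pos: "r i > 0"
    and \<mu>_pos: "0 < min_eigenvalue (A i)" if "i \<in> {1..m}" for i
    using A r that min_eigenvalue_pos[of "A i"] by blast+

  \<comment> \<open>Concavity gives
    \<open>0 < b 0 xstar - b 0 x \<le> (xstar - x) \<bullet> g0 x\<close>, and \<open>gB x\<close>
    is a positive multiple of \<open>g0 x\<close>.\<close>
  have outward: "gB x \<bullet> (x - xstar) < 0"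
    if "b 0 x = 0" "0 < (\<Prod>j\<in>{0..m}-{0}. b j x)" for x
  proof -
    have "(b 0 has_derivative (\<lambda>h. h \<bullet> g0 x)) (at x)"
      using has_C2_derivs_onD(1)[OF b0_C2, of x] by simp
    from concave_gradient_ineq[OF b0(2) this, of xstar]
    have "g0 x \<bullet> (x - xstar) < 0"
      using that(1) b0_xs by (simp add: inner_diff_left inner_diff_right inner_commute)
    then show ?thesis
      using derivs_at_zero(1)[OF _ b0_C2 that(1)] that(2) by (simp add: mult_pos_neg)
  qed
  have obstacle_gB: "gB x = (\<Prod>j\<in>{0..m}-{i}. b j x) *\<^sub>R (2 *\<^sub>R (A i *v (x - c i)))"
    if "i \<in> {1..m}" "b i x = 0" for i x
    using derivs_at_zero(1)[OF _ bi_C2[OF that(1)] that(2)] that(1) by simp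
  have gB_nonzero: "gB x \<noteq> 0" if "tb x = 0" for x
  proof -
    obtain i where i: "i \<in> {0..m}" "b i x = 0" "0 < (\<Prod>j\<in>{0..m}-{i}. b j x)"
      using total_beta_zeroE[OF disjoint] \<open>tb x = 0\<close> unfolding tb_def by blast
    show ?thesis
    proof (cases "i = 0")
      case True
      then show ?thesis using outward[of x] i by auto
    next
      case False
      then have i1: "i \<in> {1..m}" using i by simp
      have "(x - c i) \<bullet> (A i *v (x - c i)) > 0"
        using bi[rule_format, OF i1, of x] i(2) \<mu>_pos[OF i1] r_pos[OF i1] by simp
      then have "A i *v (x - c i) \<noteq> 0" by auto
      then show ?thesis using obstacle_gB[OF i1 i(2)] i(3) by (auto simp del: prod_zero_iff)
    qed
  qed
  have tb_xs: "0 < tb xstar"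
  proof (rule ccontr)
    assume "\<not> 0 < tb xstar"
    then have 0: "tb xstar = 0" using xs_F by (simp add: F_eq)
    obtain e where e: "e > 0" "ball xstar e \<subseteq> F"
      using xstar(2) mem_interior unfolding F_def by blast
    have "(tb has_derivative (\<lambda>h. h \<bullet> gB xstar)) (at xstar)"
      using has_C2_derivs_onD(1)[OF tb_C2, of xstar] by simp
    from gradient_nonzero_increase_decrease(2)[OF this gB_nonzero[OF 0] e(1)]
    obtain y where "y \<in> ball xstar e" "tb y < tb xstar" by blast
    then show False using 0 e(2) by (auto simp: F_eq)
  qed

  have hess: "lmin * (norm v)\<^sup>2 \<le> v \<bullet> (hess_f0 x *v v)" "v \<bullet> (hess_f0 x *v v) \<le> lmax * (norm v)\<^sup>2"
    if "x \<in> interior X" for x v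
  proof -
    have "x \<in> X" using that interior_subset by blast
    then have ev: "eigenvalues (hess_f0 x) \<subseteq> {lmin..lmax}" using f0_eigenvalues by blast
    note quadratic_form_bounds[OF hessian_symmetric[OF f0_C2 that] ev]
    then show "lmin * (norm v)\<^sup>2 \<le> v \<bullet> (hess_f0 x *v v)" "v \<bullet> (hess_f0 x *v v) \<le> lmax * (norm v)\<^sup>2"
      by blast+
  qed
  have lmax_pos: "0 < lmax"
  proof -
    obtain v :: "real^'n" where "norm v = 1" using vector_choose_size[of 1] by auto
    then show ?thesis using hess[OF xs_int, of v] lmin_pos by simp
  qed
  have xs_X: "xstar \<in> X" and xs_min: "\<And>y. y \<in> X \<Longrightarrow> f0 xstar \<le> f0 y"
    using xstar(1) by (auto simp: is_arg_min_linorder)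
  have grad_xs: "grad_f0 xstar = 0"
  proof (rule local_min_on_interior(1)[OF f0_C2 xs_int])
    show "local_min_on X f0 xstar"
      using xs_X xs_min by (auto simp: local_min_on_def intro: exI[of _ 1])
  qed
  have radial: "lmin * (norm (x - xstar))\<^sup>2 \<le> grad_f0 x \<bullet> (x - xstar)" if x: "x \<in> X" for x
  proof (cases "x = xstar")
    case False
    obtain t where t: "t \<in> {0<..<1}" and eq: "(grad_f0 x - grad_f0 xstar) \<bullet> (x - xstar)
        = (hess_f0 (xstar + t *\<^sub>R (x - xstar)) *v (x - xstar)) \<bullet> (x - xstar)"
      using gradient_mvt[OF X(3) xs_X x has_C2_derivs_onD(2)[OF f0_C2]] by blast
    \<comment> \<open>The point \<open>x\<close> may lie on the frontier of \<open>X\<close>, while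
      \<open>hess\<close> holds only in the interior. The open segment from the interior point
      \<open>xstar\<close> stays inside.\<close>
    have "xstar + t *\<^sub>R (x - xstar) \<in> open_segment xstar x"
      using False t by (auto simp: in_segment algebra_simps intro!: exI[of _ t])
    then have "xstar + t *\<^sub>R (x - xstar) \<in> interior X"
      using in_interior_closure_convex_segment[OF X(3) xs_int, of x] x closure_subset by blast
    from hess(1)[OF this, of "x - xstar"] show ?thesis
      using eq by (simp add: grad_xs inner_commute)
  qed simp
  have f0_pos: "0 < f0 x" if x: "x \<in> X" "x \<noteq> xstar" for x
  proof -
    obtain t where t: "t \<in> {0<..<1}"
      and eq: "f0 x - f0 xstar = (x - xstar) \<bullet> grad_f0 (xstar + t *\<^sub>R (x - xstar))"
      using mvt_segment[OF X(3) xs_X x(1) has_C2_derivs_onD(1)[OF f0_C2]] by blast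
    have z: "xstar + t *\<^sub>R (x - xstar) \<in> X"
      using convexD_alt[OF X(3) xs_X x(1), of t] t by (simp add: algebra_simps)
    \<comment> \<open>\<open>radial\<close> is applied at the intermediate point, whose displacement
      from \<open>xstar\<close> is \<open>t\<close> times that of \<open>x\<close>.\<close>
    have "0 < lmin * (norm (t *\<^sub>R (x - xstar)))\<^sup>2" using lmin_pos t x(2) by simp
    also have "\<dots> \<le> t * (f0 x - f0 xstar)"
      using radial[OF z] by (simp add: eq inner_commute)
    finally have "f0 xstar < f0 x" using t by (simp add: zero_less_mult_iff)
    then show ?thesis using f0_nonneg xs_X by (metis le_less_trans)
  qed

  have saddle: "gB x \<bullet> (x - xstar) < 0 \<or>
      0 < (norm (x - xstar))\<^sup>2 * (v \<bullet> (HB x *v v)) - lmax / lmin * (gB x \<bullet> (x - xstar))"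
    if "tb x = 0" and v: "norm v = 1" "gB x \<bullet> v = 0" for x v
  proof -
    obtain i where i: "i \<in> {0..m}" "b i x = 0" and R: "0 < (\<Prod>j\<in>{0..m}-{i}. b j x)" (is "0 < ?R")
      using total_beta_zeroE[OF disjoint] \<open>tb x = 0\<close> unfolding tb_def by blast
    show ?thesis
    proof (cases "i = 0")
      case True
      then show ?thesis using outward[of x] i R by auto
    next
      case False
      then have i1: "i \<in> {1..m}" using i by simp
      define \<mu> M where "\<mu> = min_eigenvalue (A i)" and "M = max_eigenvalue (A i)"
      define y z where "y = x - c i" and "z = xstar - c i"
      define d where "d = norm z"
      have \<mu>: "0 < \<mu>" and ri: "0 < r i" using \<mu>_pos[OF i1] r_pos[OF i1] by (auto simp: \<mu>_def)
      have yz: "y - z = x - xstar" by (simp add: y_def z_def)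
      have "x \<noteq> xstar" using \<open>tb x = 0\<close> tb_xs by auto
      then have N: "0 < (norm (y - z))\<^sup>2" by (simp add: yz)
      have key: "(A i *v y) \<bullet> (y - z) * (r i + d) \<le> M * r i * (norm (y - z))\<^sup>2"
        unfolding d_def
      proof (rule ellipsoid_inequality[OF A_sym[OF i1] A_pd[OF i1] _ _ \<mu> ri])
        show "y \<bullet> (A i *v y) = \<mu> * (r i)\<^sup>2"
          using bi[rule_format, OF i1, of x] i(2) by (simp add: y_def \<mu>_def)
        show "z \<bullet> (A i *v z) \<ge> \<mu> * (r i)\<^sup>2"
          using bi[rule_format, OF i1, of xstar] b_F[OF xs_F i(1)] by (simp add: z_def \<mu>_def)
      qed (simp_all add: \<mu>_def M_def min_max_eigenvalue_bounds[OF A_sym[OF i1]])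
      \<comment> \<open>The hypothesis times \<open>\<mu> * r i\<close> and the squared distance is
        compared with \<open>key\<close> times \<open>lmax / lmin\<close>; the common factor
        \<open>r i + d\<close> then cancels.\<close>
      have "lmax / lmin * (M / \<mu>) < 1 + d / r i"
        using cond i1 by (simp add: M_def \<mu>_def d_def z_def norm_minus_commute)
      then have "lmax / lmin * (M / \<mu>) * (\<mu> * r i) < (1 + d / r i) * (\<mu> * r i)"
        using \<mu> ri by (intro mult_strict_right_mono) simp_all
      moreover have "lmax / lmin * (M / \<mu>) * (\<mu> * r i) = lmax / lmin * M * r i"
        "(1 + d / r i) * (\<mu> * r i) = \<mu> * (r i + d)"
        using \<mu> ri by (simp_all add: algebra_simps)
      ultimately have "lmax / lmin * M * r i < \<mu> * (r i + d)" by simp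
      then have "lmax / lmin * M * r i * (norm (y - z))\<^sup>2 < \<mu> * (r i + d) * (norm (y - z))\<^sup>2"
        using N by (rule mult_strict_right_mono)
      moreover have "lmax / lmin * ((A i *v y) \<bullet> (y - z) * (r i + d)) \<le> lmax / lmin * (M * r i * (norm (y - z))\<^sup>2)"
        using lmin_pos lmax_pos by (intro mult_left_mono[OF key]) simp
      ultimately have "(lmax / lmin * ((A i *v y) \<bullet> (y - z))) * (r i + d) < (\<mu> * (norm (y - z))\<^sup>2) * (r i + d)"
        by (simp add: mult_ac)
      then have lt: "lmax / lmin * ((A i *v y) \<bullet> (y - z)) < \<mu> * (norm (y - z))\<^sup>2"
        by (rule mult_right_less_imp_less) (use ri in \<open>simp add: d_def\<close>)
      have gB: "gB x = ?R *\<^sub>R (2 *\<^sub>R (A i *v y))"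
        using obstacle_gB[OF i1 i(2)] by (simp add: y_def)
      \<comment> \<open>The formula for \<open>HB\<close> applies only to vectors tangent to the
        ellipsoid; \<open>v\<close> is one because \<open>gB x\<close> is a positive multiple of the
        ellipsoid's gradient.\<close>
      have "v \<bullet> (2 *\<^sub>R (A i *v y)) = 0" using v(2) R by (auto simp: gB inner_commute simp del: prod_zero_iff)
      then have HB: "v \<bullet> (HB x *v v) = ?R * (2 * (v \<bullet> (A i *v v)))"
        using derivs_at_zero(2)[OF i(1) bi_C2[OF i1] i(2), of v]
        by (simp add: y_def scaleR_matrix_vector_mult)
      have "\<mu> \<le> v \<bullet> (A i *v v)"
        using min_max_eigenvalue_bounds(1)[OF A_sym[OF i1], of v] v(1) by (simp add: \<mu>_def)
      then have "\<mu> * (norm (y - z))\<^sup>2 \<le> (v \<bullet> (A i *v v)) * (norm (y - z))\<^sup>2"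
        by (intro mult_right_mono) auto
      with lt have "0 < (2 * ?R) * ((v \<bullet> (A i *v v)) * (norm (y - z))\<^sup>2 - lmax / lmin * ((A i *v y) \<bullet> (y - z)))"
        using R by (intro mult_pos_pos) linarith+
      then show ?thesis
        unfolding gB HB yz by (simp add: algebra_simps)
    qed
  qed
  have "\<forall>x. tb x = 0 \<longrightarrow> gB x \<bullet> (x - xstar) < 0" if "\<not> 2 \<le> CARD('n)"
  proof -
    from that have "CARD('n) = 1" using zero_less_card_finite[where 'a='n] by linarith
    then have no_obstacle: "i \<notin> {1..m}" for i
      using obstacle_disconnects_line[OF _ disjoint F_manifold(2), of i "c i" "A i" "min_eigenvalue (A i) * (r i)\<^sup>2"]
        bi A_pd[of i] \<mu>_pos[of i] r_pos[of i] by auto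
    show "\<forall>x. tb x = 0 \<longrightarrow> gB x \<bullet> (x - xstar) < 0"
    proof (intro allI impI)
      fix x assume "tb x = 0"
      then obtain i where i: "i \<in> {0..m}" "b i x = 0" "0 < (\<Prod>j\<in>{0..m}-{i}. b j x)"
        using total_beta_zeroE[OF disjoint] unfolding tb_def by blast
      have "i = 0" using no_obstacle[of i] i(1) by (cases i) auto
      then show "gB x \<bullet> (x - xstar) < 0" using outward[of x] i by simp
    qed
  qed
  then have dim: "2 \<le> CARD('n) \<or> (\<forall>x. tb x = 0 \<longrightarrow> gB x \<bullet> (x - xstar) < 0)" by blast

  interpret koditschek_rimon_potential f0 tb grad_f0 gB hess_f0 HB F xstar lmin lmax
  proof
    show "compact F" using F_manifold(1) by (simp add: F_def)
    show "has_C2_derivs_on f0 grad_f0 hess_f0 F" by (rule has_C2_derivs_on_subset[OF f0_C2 F_X])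
  next
    fix x assume x: "0 < tb x"
    have "x \<in> interior X" by (rule int_X) (rule b_pos[OF x], simp)
    then show "\<And>v. lmin * (norm v)\<^sup>2 \<le> v \<bullet> (hess_f0 x *v v)"
      "\<And>v. v \<bullet> (hess_f0 x *v v) \<le> lmax * (norm v)\<^sup>2" using hess by blast+
  qed (use F_eq tb_C2 f0_nonneg f0_pos F_X tb_xs grad_xs lmin_pos radial gB_nonzero saddle dim in blast)+
  have \<phi>_eq: "\<phi> k = potential f0 m b k" for k
    by (rule ext) (simp only: \<phi>_def q_def potential_def tb_def[symmetric])
  have gderiv: "gB xstar = 0" if "GDERIV (total_beta m b) xstar :> 0"
  proof -
    have "(\<lambda>h. h \<bullet> gB xstar) = (\<lambda>h. h \<bullet> 0)"
      using has_derivative_unique[OF \<beta>_has_derivative[of xstar]] that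
      unfolding gderiv_def tb_def by blast
    then show ?thesis by (metis inner_eq_zero_iff inner_zero_right)
  qed
  show ?thesis
  proof (intro allI impI)
    fix \<epsilon> :: real assume "\<epsilon> > 0"
    from navigation_function_\<phi>[OF this] gderiv
    show "\<exists>K. \<forall>k>K. \<exists>xbar. navigation_function (free_space m b) (potential f0 m b k) xbar \<and>
        norm (xbar - xstar) < \<epsilon> \<and> (f0 xstar = 0 \<or> GDERIV (total_beta m b) xstar :> 0 \<longrightarrow> xbar = xstar)"
      unfolding \<phi>_eq F_def by metis
  qed
qed

end
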